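(* For every integer $n\geq 1$, the lattice polytope $R_n\subset\mathbb{R}^n$ admits a regular, flag, unimodular triangulation.
   Context: $R_n$ is the convex hull of the $n$ columns of the $n\times n$ upper triangular matrix whose first row is all $1$'s, whose diagonal is $(1,n-1,n-2,\ldots,1)$, and whose entries above the diagonal are all $1$; i.e. the columns are $e_1=(1,0,\ldots,0)$ and, for $2\le j\le n$, the vector with coordinates $1,\ldots,j-1$ equal to $1$, $j$th coordinate $n-j+1$, and remaining coordinates $0$. It is an $(n-1)$-dimensional simplex lying in the hyperplane $x_1=1$, and unimodularity is with respect to the lattice $\mathbb{Z}^n\cap\{x_1=1\}$. (The cone over $R_n$ is unimodularly equivalent to the lecture hall cone $L_n=\{\lambda\in\mathbb{R}^n:0\le\lambda_1/1\le\lambda_2/2\le\cdots\le\lambda_n/n\}$.) A triangulation is unimodular if every maximal simplex is unimodular; regular if it is the set of domains of linearity of some convex piecewise-linear function on the polytope; flag if, as a simplicial complex, all its minimal non-faces have two vertices. *)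

theory Defs
  imports "HOL-Analysis.Analysis"
begin

section \<open>The simplex \<open>R\<^sub>n\<close>\<close>

text \<open>
  Here \<open>n = CARD('n)\<close>, and the finite linearly ordered index type \<open>'n\<close> is identified
  with \<open>{1..n}\<close> through the following numbering.
\<close>

definition pos :: "'n::{finite,linorder} \<Rightarrow> nat" where
  "pos i = card {..i}"

lemma pos_less_iff: "pos i < pos j \<longleftrightarrow> i < j"
proof -
  have "pos i < pos j" if "i < j" for i j :: 'a
    unfolding pos_def using that by (intro psubset_card_mono) auto
  then show ?thesis
    by (metis less_irrefl less_trans linorder_neqE)
qed

lemma bij_betw_pos: "bij_betw pos (UNIV :: 'n::{finite,linorder} set) {1..CARD('n)}"
proof -
  have inj: "inj (pos :: 'n \<Rightarrow> nat)"
    by (rule injI) (metis pos_less_iff linorder_neqE less_irrefl)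
  have "range (pos :: 'n \<Rightarrow> nat) \<subseteq> {1..CARD('n)}"
    by (auto simp: pos_def Suc_le_eq card_gt_0_iff intro!: card_mono)
  moreover have "card (range (pos :: 'n \<Rightarrow> nat)) = card {1..CARD('n)}"
    by (simp add: card_image inj)
  ultimately have "range (pos :: 'n \<Rightarrow> nat) = {1..CARD('n)}"
    by (intro card_subset_eq) auto
  with inj show ?thesis
    by (simp add: bij_betw_def)
qed

definition R_matrix :: "real^('n::{finite,linorder})^('n::{finite,linorder})" where
  "R_matrix = (\<chi> i j.
     if pos i > pos j then 0
     else if pos i = pos j \<and> pos j \<noteq> 1 then real CARD('n) - real (pos j) + 1
     else 1)"

definition R_polytope :: "(real^'n::{finite,linorder}) set" where
  "R_polytope = convex hull (columns R_matrix)"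

text \<open>The affine lattice \<open>\<int>\<^sup>n \<inter> {x. x\<^sub>1 = 1}\<close>.\<close>

definition R_lattice :: "(real^'n::{finite,linorder}) set" where
  "R_lattice = {x. (\<forall>i. x $ i \<in> \<int>) \<and> (\<forall>i. pos i = 1 \<longrightarrow> x $ i = 1)}"


section \<open>Triangulations\<close>

text \<open>
  As in \<^const>\<open>simplicial_complex\<close>, a triangulation is the set of all its simplices,
  including lower-dimensional faces and the empty face.
\<close>

definition triangulates :: "'a::euclidean_space set set \<Rightarrow> 'a set \<Rightarrow> bool" where
  "triangulates \<T> P \<longleftrightarrow> simplicial_complex \<T> \<and> \<Union>\<T> = P"

definition maximal_simplices :: "'a set set \<Rightarrow> 'a set set" where
  "maximal_simplices \<T> = {S \<in> \<T>. \<forall>S'\<in>\<T>. S \<subseteq> S' \<longrightarrow> S' = S}"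

definition vertices :: "'a::real_vector set \<Rightarrow> 'a set" where
  "vertices S = {v. v extreme_point_of S}"

subsection \<open>Unimodularity\<close>

text \<open>
  The vertices form an affine lattice basis: the affinely independent vertices of the
  simplex generate the affine lattice \<open>\<Lambda>\<close> under integer affine combinations.
\<close>

definition unimodular_simplex :: "'a::euclidean_space set \<Rightarrow> 'a set \<Rightarrow> bool" where
  "unimodular_simplex \<Lambda> S \<longleftrightarrow>
     (\<exists>d. d simplex S) \<and>
     \<Lambda> = {(\<Sum>v\<in>vertices S. of_int (c v) *\<^sub>R v) | c :: 'a \<Rightarrow> int. (\<Sum>v\<in>vertices S. c v) = 1}"

definition unimodular_triangulation :: "'a::euclidean_space set \<Rightarrow> 'a set set \<Rightarrow> bool" where
  "unimodular_triangulation \<Lambda> \<T> \<longleftrightarrow> (\<forall>S\<in>maximal_simplices \<T>. unimodular_simplex \<Lambda> S)"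

subsection \<open>Regularity\<close>

definition affine_function_on :: "'a::real_inner set \<Rightarrow> ('a \<Rightarrow> real) \<Rightarrow> bool" where
  "affine_function_on D f \<longleftrightarrow> (\<exists>a b. \<forall>x\<in>D. f x = a \<bullet> x + b)"

definition piecewise_linear_on :: "'a::euclidean_space set \<Rightarrow> ('a \<Rightarrow> real) \<Rightarrow> bool" where
  "piecewise_linear_on P f \<longleftrightarrow>
     (\<exists>\<D>. finite \<D> \<and> (\<forall>D\<in>\<D>. polytope D \<and> affine_function_on D f) \<and> \<Union>\<D> = P)"

text \<open>
  Domains of linearity are the maximal convex regions on which the function is affine.
  Convexity of the regions matters: without it, the two points where \<open>\<bar>x\<bar>\<close> takes
  the value 1 would already be a maximal set on which \<open>\<bar>x\<bar>\<close> agrees with an affine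
  function.
\<close>

definition linearity_domains :: "'a::euclidean_space set \<Rightarrow> ('a \<Rightarrow> real) \<Rightarrow> 'a set set" where
  "linearity_domains P f =
     {D. D \<subseteq> P \<and> convex D \<and> affine_function_on D f \<and>
         (\<forall>D'. D \<subseteq> D' \<and> D' \<subseteq> P \<and> convex D' \<and> affine_function_on D' f \<longrightarrow> D' = D)}"

definition regular_triangulation :: "'a::euclidean_space set \<Rightarrow> 'a set set \<Rightarrow> bool" where
  "regular_triangulation P \<T> \<longleftrightarrow>
     (\<exists>f. convex_on P f \<and> piecewise_linear_on P f \<and>
          maximal_simplices \<T> = linearity_domains P f)"

subsection \<open>Flagness\<close>

text \<open>The underlying abstract simplicial complex, whose faces are sets of vertices.\<close>

definition abstract_faces :: "'a::real_vector set set \<Rightarrow> 'a set set" where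
  "abstract_faces \<T> = vertices ` \<T>"

definition minimal_nonface :: "'a::real_vector set set \<Rightarrow> 'a set \<Rightarrow> bool" where
  "minimal_nonface \<T> W \<longleftrightarrow>
     W \<subseteq> \<Union>(abstract_faces \<T>) \<and> W \<notin> abstract_faces \<T> \<and>
     (\<forall>W'. W' \<subset> W \<longrightarrow> W' \<in> abstract_faces \<T>)"

definition flag_triangulation :: "'a::real_vector set set \<Rightarrow> bool" where
  "flag_triangulation \<T> \<longleftrightarrow> (\<forall>W. minimal_nonface \<T> W \<longrightarrow> card W = 2)"

end

theory Submission
  imports Defs "HOL-Computational_Algebra.Group_Closure"
begin

text \<open>
  Put \<open>\<lambda>\<^sub>i = x\<^sub>n + \<dots> + x\<^sub>n\<^sub>+\<^sub>1\<^sub>-\<^sub>i\<close> and \<open>m = n - 1\<close>. Then \<open>R\<^sub>n\<close> is the slice \<open>x\<^sub>1 = 1\<close> of the cone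
  \<open>0 \<le> \<lambda>\<^sub>1/1 \<le> \<dots> \<le> \<lambda>\<^sub>m/m \<le> x\<^sub>1\<close>. Forgetting the second coordinate \<open>y = x\<^sub>2\<close> maps \<open>R\<^sub>n\<close> onto
  \<open>R\<^sub>n\<^sub>-\<^sub>1\<close>, and \<open>R\<^sub>n\<close> is the union of the chimney \<open>1 \<le> y \<le> u(q)\<close> over \<open>R\<^sub>n\<^sub>-\<^sub>1\<close>, where
  \<open>u(q) = m - \<lambda>\<^sub>m\<^sub>-\<^sub>1(q)\<close> is affine and integral, and of the pyramid of height one over the floor
  \<open>y = 1\<close> of this chimney with apex \<open>e\<^sub>1\<close>. Given a triangulation of \<open>R\<^sub>n\<^sub>-\<^sub>1\<close>, the floor is coned off
  from the apex, and above each simplex of the base the chimney is filled by a staircase: starting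
  from the floor, the vertices are raised by one unit at a time, in the order prescribed by an
  injective clock \<open>\<tau>\<close>. Two lattice points above a common simplex are adjacent iff the time intervals
  during which they are present overlap, so flagness follows from Helly's theorem on the line.
  The clock also serves as slope: lifting \<open>q + h b\<close> to the height \<open>L w(q) + \<tau>(1, q) + \<dots> + \<tau>(h - 1, q)\<close>
  and the apex to the height \<open>H\<close>, with \<open>L\<close> large and \<open>H\<close> much larger, shows that the triangulation
  is regular.
\<close>

section \<open>Regular triangulations from lifted vertices\<close>

text \<open>\<open>M\<close> consists of the lower facets of the points lifted to the heights
  \<open>w\<close>: each carries an affine function that meets \<open>w\<close> exactly there.
  \<open>antichain\<close> keeps the hull of one facet from being a proper face of another, so that
  the facets span the maximal simplices.\<close>

locale weighted_facets =
  fixes M :: "'a::euclidean_space set set" and w :: "'a \<Rightarrow> real"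
  assumes finite_M: "finite M" and M_nonempty: "M \<noteq> {}"
    and indep: "F \<in> M \<Longrightarrow> \<not> affine_dependent F"
    and antichain: "F \<in> M \<Longrightarrow> F' \<in> M \<Longrightarrow> F \<subseteq> F' \<Longrightarrow> F = F'"
    and support: "F \<in> M \<Longrightarrow>
      \<exists>a c. (\<forall>v\<in>F. a \<bullet> v + c = w v) \<and> (\<forall>v\<in>\<Union>M - F. a \<bullet> v + c < w v)"
begin

section \<open>Supporting affine functions and their maximum\<close>

definition affine_piece :: "'a set \<Rightarrow> 'a \<Rightarrow> real" where
  "affine_piece F = (SOME f. (\<exists>a c. f = (\<lambda>x. a \<bullet> x + c)) \<and>
     (\<forall>v\<in>F. f v = w v) \<and> (\<forall>v\<in>\<Union>M - F. f v < w v))"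

text \<open>A maximum of affine functions is convex and defined on the whole space; on the hull of
  each facet it interpolates \<open>w\<close> linearly.\<close>

definition envelope :: "'a \<Rightarrow> real" where
  "envelope x = Max ((\<lambda>F. affine_piece F x) ` M)"

definition simplices :: "'a set set" where
  "simplices = {convex hull G |G F. F \<in> M \<and> G \<subseteq> F}"

lemma affine_piece_props:
  assumes "F \<in> M"
  shows "(\<exists>a c. affine_piece F = (\<lambda>x. a \<bullet> x + c)) \<and>
     (\<forall>v\<in>F. affine_piece F v = w v) \<and> (\<forall>v\<in>\<Union>M - F. affine_piece F v < w v)"
proof -
  obtain a c where "\<forall>v\<in>F. a \<bullet> v + c = w v" "\<forall>v\<in>\<Union>M - F. a \<bullet> v + c < w v"
    using support[OF assms] by blast
  then have "\<exists>f. (\<exists>a c. f = (\<lambda>x. a \<bullet> x + c)) \<and>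
     (\<forall>v\<in>F. f v = w v) \<and> (\<forall>v\<in>\<Union>M - F. f v < w v)"
    by (intro exI[of _ "\<lambda>x. a \<bullet> x + c"]) auto
  then show ?thesis
    unfolding affine_piece_def by (rule someI_ex)
qed

lemma affine_piece_affine:
  assumes "F \<in> M"
  obtains a c where "\<And>x. affine_piece F x = a \<bullet> x + c"
  using affine_piece_props[OF assms] by metis

lemma affine_piece_eq: "F \<in> M \<Longrightarrow> v \<in> F \<Longrightarrow> affine_piece F v = w v"
  using affine_piece_props by blast

lemma affine_piece_less:
  "F \<in> M \<Longrightarrow> F' \<in> M \<Longrightarrow> v \<in> F' \<Longrightarrow> v \<notin> F \<Longrightarrow> affine_piece F v < w v"
  using affine_piece_props by blast

lemma affine_piece_le: "F \<in> M \<Longrightarrow> F' \<in> M \<Longrightarrow> v \<in> F' \<Longrightarrow> affine_piece F v \<le> w v"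
  using affine_piece_eq affine_piece_less by (metis less_le order_refl)

lemma affine_piece_combination:
  assumes "F \<in> M" "sum u I = 1"
  shows "affine_piece F (\<Sum>i\<in>I. u i *\<^sub>R p i) = (\<Sum>i\<in>I. u i * affine_piece F (p i))"
proof -
  obtain a c where a: "\<And>x. affine_piece F x = a \<bullet> x + c"
    using affine_piece_affine[OF assms(1)] by blast
  have "(\<Sum>i\<in>I. u i * (a \<bullet> p i + c)) = (\<Sum>i\<in>I. u i * (a \<bullet> p i)) + c * sum u I"
    by (simp add: algebra_simps sum.distrib sum_distrib_left)
  then show ?thesis
    using assms(2) by (simp add: a inner_sum_right)
qed

lemma finite_facet: "F \<in> M \<Longrightarrow> finite F"
  using indep aff_independent_finite by blast

text \<open>In barycentric coordinates on \<open>F\<close>, the difference of the two pieces is a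
  sum of products of a weight and a gap \<open>w v - affine_piece F' v\<close>, both nonnegative.
  The gap is positive off \<open>F'\<close>, so equality forces every weight outside
  \<open>F \<inter> F'\<close> to vanish.\<close>

lemma affine_piece_max:
  assumes F: "F \<in> M" and F': "F' \<in> M" and x: "x \<in> convex hull F"
  shows "affine_piece F' x \<le> affine_piece F x"
    and "affine_piece F' x = affine_piece F x \<Longrightarrow> x \<in> convex hull (F \<inter> F')"
proof -
  obtain u where u: "\<forall>v\<in>F. 0 \<le> u v" "sum u F = 1" "(\<Sum>v\<in>F. u v *\<^sub>R v) = x"
    using x unfolding convex_hull_finite[OF finite_facet[OF F]] by blast
  have "affine_piece F x = (\<Sum>v\<in>F. u v * w v)"
    using affine_piece_combination[OF F u(2), of "\<lambda>v. v"] affine_piece_eq[OF F] u(3) by simp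
  moreover have "affine_piece F' x = (\<Sum>v\<in>F. u v * affine_piece F' v)"
    using affine_piece_combination[OF F' u(2), of "\<lambda>v. v"] u(3) by simp
  ultimately have eq: "affine_piece F x - affine_piece F' x = (\<Sum>v\<in>F. u v * (w v - affine_piece F' v))"
    by (simp add: algebra_simps sum_subtractf)
  have nonneg: "0 \<le> u v * (w v - affine_piece F' v)" if "v \<in> F" for v
    using u(1) that affine_piece_le[OF F' F that] by simp
  show "affine_piece F' x \<le> affine_piece F x"
    using eq sum_nonneg[of F "\<lambda>v. u v * (w v - affine_piece F' v)", OF nonneg] by linarith
  assume "affine_piece F' x = affine_piece F x"
  then have "(\<Sum>v\<in>F. u v * (w v - affine_piece F' v)) = 0"
    using eq by simp
  then have "\<forall>v\<in>F. u v * (w v - affine_piece F' v) = 0"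
    by (subst (asm) sum_nonneg_eq_0_iff[OF finite_facet[OF F] nonneg])
  then have zero: "u v = 0" if "v \<in> F" "v \<notin> F'" for v
    using affine_piece_less[OF F' F, of v] that by force
  have "sum u (F \<inter> F') = sum u F" "(\<Sum>v\<in>F \<inter> F'. u v *\<^sub>R v) = (\<Sum>v\<in>F. u v *\<^sub>R v)"
    by (intro sum.mono_neutral_left; use zero finite_facet[OF F] in simp)+
  then show "x \<in> convex hull (F \<inter> F')"
    using u finite_facet[OF F] by (auto simp: convex_hull_finite)
qed

lemma envelope_ge: "F \<in> M \<Longrightarrow> affine_piece F x \<le> envelope x"
  unfolding envelope_def using finite_M by (intro Max_ge) auto

lemma envelope_attained: obtains F where "F \<in> M" "envelope x = affine_piece F x"
proof -
  have "envelope x \<in> (\<lambda>F. affine_piece F x) ` M"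
    unfolding envelope_def using finite_M M_nonempty by (intro Max_in) auto
  then show ?thesis
    using that by blast
qed

lemma envelope_eq:
  assumes "F \<in> M" "x \<in> convex hull F"
  shows "envelope x = affine_piece F x"
  using affine_piece_max(1)[OF assms(1) _ assms(2)] envelope_ge[OF assms(1), of x]
  by (metis envelope_attained order_antisym)

section \<open>Faces of the facets as a simplicial complex\<close>

lemma convex_hull_Int_simplices:
  assumes F: "F \<in> M" "G \<subseteq> F" and F': "F' \<in> M" "G' \<subseteq> F'"
  shows "convex hull G \<inter> convex hull G' = convex hull (G \<inter> G')"
proof
  show "convex hull (G \<inter> G') \<subseteq> convex hull G \<inter> convex hull G'"
    by (simp add: hull_mono)
  show "convex hull G \<inter> convex hull G' \<subseteq> convex hull (G \<inter> G')"
  proof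
    fix x assume x: "x \<in> convex hull G \<inter> convex hull G'"
    then have xF: "x \<in> convex hull F" and xF': "x \<in> convex hull F'"
      using hull_mono[OF F(2)] hull_mono[OF F'(2)] by auto
    \<comment> \<open>Both pieces agree with \<open>envelope\<close> at a common point, which is the
      equality case of \<open>affine_piece_max\<close>.\<close>
    have "affine_piece F x = affine_piece F' x"
      using envelope_eq[OF F(1) xF] envelope_eq[OF F'(1) xF'] by simp
    then have FF': "x \<in> convex hull (F \<inter> F')"
      using affine_piece_max(2)[OF F(1) F'(1) xF] by simp
    \<comment> \<open>Inside one affinely independent facet, hulls of subsets meet in the hull of
      the intersection. This is used once in each facet and once more for the two traces on
      \<open>F \<inter> F'\<close>.\<close>
    have 1: "convex hull S \<inter> convex hull S' = convex hull (S \<inter> S')" if "S \<subseteq> H" "S' \<subseteq> H" "H \<in> M" for S S' H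
      using convex_hull_Int[of S S'] affine_independent_subset[OF indep[OF that(3)], of "S \<union> S'"] that by simp
    have "x \<in> convex hull (G \<inter> (F \<inter> F'))" "x \<in> convex hull (G' \<inter> (F \<inter> F'))"
      using 1[of G F "F \<inter> F'"] 1[of G' F' "F \<inter> F'"] x FF' F F' by auto
    then have "x \<in> convex hull ((G \<inter> (F \<inter> F')) \<inter> (G' \<inter> (F \<inter> F')))"
      using 1[of "G \<inter> (F \<inter> F')" F "G' \<inter> (F \<inter> F')"] F by blast
    moreover have "(G \<inter> (F \<inter> F')) \<inter> (G' \<inter> (F \<inter> F')) = G \<inter> G'"
      using F F' by blast
    ultimately show "x \<in> convex hull (G \<inter> G')"
      by simp
  qed
qed

lemma vertices_convex_hull:
  assumes "F \<in> M" "G \<subseteq> F"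
  shows "vertices (convex hull G) = G"
  unfolding vertices_def
    extreme_point_of_convex_hull_affine_independent[OF affine_independent_subset[OF indep[OF assms(1)] assms(2)]]
  by simp

lemma facet_subset: "F \<in> M \<Longrightarrow> F' \<in> M \<Longrightarrow> convex hull F \<subseteq> convex hull F' \<Longrightarrow> F = F'"
proof -
  assume F: "F \<in> M" "F' \<in> M" "convex hull F \<subseteq> convex hull F'"
  then have "convex hull (F \<inter> F') = convex hull F"
    using convex_hull_Int_simplices[of F F F' F'] by auto
  then have "F \<inter> F' = F"
    using vertices_convex_hull[OF F(1)] by (metis Int_lower1 order_refl)
  then show "F = F'"
    using antichain F by blast
qed

lemma simplicial_complex_simplices: "simplicial_complex simplices"
  unfolding simplicial_complex_def
proof (intro conjI ballI allI impI)
  have "simplices \<subseteq> (\<lambda>G. convex hull G) ` Pow (\<Union>M)"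
    by (auto simp: simplices_def)
  then show "finite simplices"
    using finite_M finite_facet by (meson finite_Pow_iff finite_Union finite_imageI finite_subset)
next
  fix S assume "S \<in> simplices"
  then obtain G F where S: "S = convex hull G" "F \<in> M" "G \<subseteq> F"
    by (auto simp: simplices_def)
  then have "int (card G) - 1 simplex S"
    using affine_independent_subset[OF indep] unfolding simplex_def by auto
  then show "\<exists>n. n simplex S" ..
next
  fix T S assume "S \<in> simplices \<and> T face_of S"
  then obtain G F where S: "S = convex hull G" "F \<in> M" "G \<subseteq> F" "T face_of S"
    by (auto simp: simplices_def)
  then obtain c where "c \<subseteq> G" "T = convex hull c"
    using face_of_convex_hull_affine_independent[of G] affine_independent_subset[OF indep] by metis
  then show "T \<in> simplices"
    using S by (auto simp: simplices_def)
next
  fix S T assume "S \<in> simplices \<and> T \<in> simplices"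
  then obtain G F G' F' where S: "S = convex hull G" "F \<in> M" "G \<subseteq> F" "T = convex hull G'" "F' \<in> M" "G' \<subseteq> F'"
    by (auto simp: simplices_def)
  then show "S \<inter> T face_of S"
    using convex_hull_Int_simplices[of F G F' G']
      face_of_convex_hull_affine_independent[of G] affine_independent_subset[OF indep, of F G]
    by (metis Int_lower1)
qed

lemma triangulates_simplices: "triangulates simplices (\<Union>F\<in>M. convex hull F)"
proof -
  have "\<Union>simplices = (\<Union>F\<in>M. convex hull F)"
    using hull_mono by (fastforce simp: simplices_def)
  then show ?thesis
    using simplicial_complex_simplices by (simp add: triangulates_def)
qed

lemma maximal_simplices_eq: "maximal_simplices simplices = (\<lambda>F. convex hull F) ` M"
proof (intro equalityI subsetI)
  fix S assume "S \<in> maximal_simplices simplices"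
  then obtain G F where S: "S = convex hull G" "F \<in> M" "G \<subseteq> F"
    and max: "\<And>S'. S' \<in> simplices \<Longrightarrow> S \<subseteq> S' \<Longrightarrow> S' = S"
    by (auto simp: simplices_def maximal_simplices_def)
  then have "convex hull F = S"
    by (intro max) (auto simp: simplices_def hull_mono)
  then show "S \<in> (\<lambda>F. convex hull F) ` M"
    using S by auto
next
  fix S assume "S \<in> (\<lambda>F. convex hull F) ` M"
  then obtain F where F: "F \<in> M" "S = convex hull F"
    by auto
  have "S' = S" if S': "S' \<in> simplices" "S \<subseteq> S'" for S'
  proof -
    obtain G F' where G: "S' = convex hull G" "F' \<in> M" "G \<subseteq> F'"
      using S' by (auto simp: simplices_def)
    then have "F = F'"
      using facet_subset F S' hull_mono[OF G(3)] by blast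
    then show ?thesis
      using G F S'(2) hull_mono[OF G(3)] by blast
  qed
  then show "S \<in> maximal_simplices simplices"
    using F by (auto simp: maximal_simplices_def simplices_def)
qed

section \<open>Domains of linearity and regularity\<close>

text \<open>If every piece were strictly below \<open>envelope\<close> somewhere on \<open>D\<close>, then all of them
  would be so at the barycentre of these points, but the envelope is one of its pieces there.\<close>

lemma linearity_subset_facet:
  assumes D: "convex D" "D \<subseteq> (\<Union>F\<in>M. convex hull F)" "affine_function_on D envelope"
  obtains F where "F \<in> M" "D \<subseteq> convex hull F"
proof -
  obtain a c where g: "\<And>x. x \<in> D \<Longrightarrow> envelope x = a \<bullet> x + c"
    using D(3) by (auto simp: affine_function_on_def)
  have "\<exists>F\<in>M. \<forall>x\<in>D. envelope x = affine_piece F x"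
  proof (rule ccontr)
    assume "\<not> ?thesis"
    then obtain p where p: "\<And>F. F \<in> M \<Longrightarrow> p F \<in> D" "\<And>F. F \<in> M \<Longrightarrow> envelope (p F) \<noteq> affine_piece F (p F)"
      by metis
    \<comment> \<open>Every weight is positive, so that the strict inequality at \<open>p F\<close>
      survives in the average.\<close>
    define u where "u = (\<lambda>F::'a set. 1 / real (card M))"
    have u: "sum u M = 1" "\<And>F. 0 < u F"
      using finite_M M_nonempty by (auto simp: u_def card_gt_0_iff)
    define z where "z = (\<Sum>F\<in>M. u F *\<^sub>R p F)"
    have z: "z \<in> D"
      unfolding z_def using u p finite_M by (intro convex_sum[OF _ D(1)]) (auto intro: less_imp_le)
    obtain F where F: "F \<in> M" "envelope z = affine_piece F z"
      using envelope_attained by blast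
    have "affine_piece F z = (\<Sum>H\<in>M. u H * affine_piece F (p H))"
      unfolding z_def by (rule affine_piece_combination[OF F(1) u(1)])
    also have "\<dots> < (\<Sum>H\<in>M. u H * envelope (p H))"
    proof (rule sum_strict_mono_strong[OF finite_M F(1)])
      show "u F * affine_piece F (p F) < u F * envelope (p F)"
        using u(2) p(2)[OF F(1)] envelope_ge[OF F(1), of "p F"] by (intro mult_strict_left_mono) auto
    qed (use u(2) envelope_ge[OF F(1)] in \<open>auto intro!: mult_left_mono less_imp_le\<close>)
    also have "\<dots> = (\<Sum>H\<in>M. u H * (a \<bullet> p H)) + c * sum u M"
      using g p(1) by (simp add: algebra_simps sum.distrib sum_distrib_left)
    also have "\<dots> = a \<bullet> z + c"
      by (simp add: z_def inner_sum_right u(1))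
    also have "\<dots> = envelope z"
      using g z by simp
    finally show False
      using F by simp
  qed
  then obtain F where F: "F \<in> M" "\<And>x. x \<in> D \<Longrightarrow> envelope x = affine_piece F x"
    by blast
  have "D \<subseteq> convex hull F"
  proof
    fix x assume x: "x \<in> D"
    then obtain F' where F': "F' \<in> M" "x \<in> convex hull F'"
      using D(2) by auto
    \<comment> \<open>The facet \<open>F'\<close> around \<open>x\<close> may vary with
      \<open>x\<close>, but the equality case of \<open>affine_piece_max\<close> always puts
      \<open>x\<close> into the hull of the vertices shared with \<open>F\<close>.\<close>
    then have "affine_piece F x = affine_piece F' x"
      using F(2)[OF x] envelope_eq[OF F'] by simp
    then have "x \<in> convex hull (F' \<inter> F)"
      using affine_piece_max(2)[OF F'(1) F(1) F'(2)] by simp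
    then show "x \<in> convex hull F"
      using hull_mono[of "F' \<inter> F" F] by auto
  qed
  then show ?thesis
    using that F by blast
qed

lemma affine_function_on_facet: "F \<in> M \<Longrightarrow> affine_function_on (convex hull F) envelope"
  unfolding affine_function_on_def using affine_piece_affine envelope_eq by metis

text \<open>The envelope is affine on the hull of each facet. By
  \<open>linearity_subset_facet\<close> every convex region of linearity lies in such a hull, and by
  \<open>facet_subset\<close> these hulls are not nested, so they are exactly the maximal
  regions.\<close>

lemma regular_triangulation_simplices:
  assumes P: "convex P" "P = (\<Union>F\<in>M. convex hull F)"
  shows "regular_triangulation P simplices"
  unfolding regular_triangulation_def
proof (intro exI conjI)
  show "convex_on P envelope"
    unfolding convex_on_def
  proof (intro conjI ballI allI impI)
    fix x y :: 'a and s t :: real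
    assume st: "0 \<le> s" "0 \<le> t" "s + t = 1"
    obtain F where F: "F \<in> M" "envelope (s *\<^sub>R x + t *\<^sub>R y) = affine_piece F (s *\<^sub>R x + t *\<^sub>R y)"
      using envelope_attained by blast
    obtain a c where a: "\<And>x. affine_piece F x = a \<bullet> x + c"
      using affine_piece_affine[OF F(1)] by blast
    have "affine_piece F (s *\<^sub>R x + t *\<^sub>R y) = s * (a \<bullet> x) + t * (a \<bullet> y) + (s + t) * c"
      by (simp add: a st inner_add_right)
    also have "\<dots> = s * affine_piece F x + t * affine_piece F y"
      by (simp add: a algebra_simps)
    also have "\<dots> \<le> s * envelope x + t * envelope y"
      using st F by (intro add_mono mult_left_mono envelope_ge) auto
    finally show "envelope (s *\<^sub>R x + t *\<^sub>R y) \<le> s * envelope x + t * envelope y"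
      using F by simp
  qed (rule P)
  show "piecewise_linear_on P envelope"
    unfolding piecewise_linear_on_def
    using finite_M P(2) affine_function_on_facet finite_facet
    by (intro exI[of _ "(\<lambda>F. convex hull F) ` M"]) (auto simp: polytope_def)
  show "maximal_simplices simplices = linearity_domains P envelope"
    unfolding maximal_simplices_eq
  proof (intro equalityI subsetI)
    fix S assume "S \<in> (\<lambda>F. convex hull F) ` M"
    then obtain F where F: "F \<in> M" "S = convex hull F"
      by auto
    have "D' = S" if D': "S \<subseteq> D'" "D' \<subseteq> P" "convex D'" "affine_function_on D' envelope" for D'
    proof -
      obtain F' where "F' \<in> M" "D' \<subseteq> convex hull F'"
        using linearity_subset_facet D' P(2) by metis
      then show ?thesis
        using facet_subset F D'(1) by blast
    qed
    then show "S \<in> linearity_domains P envelope"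
      using F P(2) affine_function_on_facet by (auto simp: linearity_domains_def)
  next
    fix D assume "D \<in> linearity_domains P envelope"
    then have D: "D \<subseteq> P" "convex D" "affine_function_on D envelope"
      and max: "\<And>D'. D \<subseteq> D' \<Longrightarrow> D' \<subseteq> P \<Longrightarrow> convex D' \<Longrightarrow> affine_function_on D' envelope \<Longrightarrow> D' = D"
      by (auto simp: linearity_domains_def)
    obtain F where F: "F \<in> M" "D \<subseteq> convex hull F"
      using linearity_subset_facet D P(2) by metis
    then have "convex hull F = D"
      using P(2) affine_function_on_facet by (intro max) auto
    then show "D \<in> (\<lambda>F. convex hull F) ` M"
      using F by auto
  qed
qed

section \<open>Abstract faces and flagness\<close>

lemma abstract_faces_simplices: "abstract_faces simplices = {G. \<exists>F\<in>M. G \<subseteq> F}"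
  
proof (intro equalityI subsetI)
  fix W assume "W \<in> abstract_faces simplices"
  then obtain G F where "W = vertices (convex hull G)" "F \<in> M" "G \<subseteq> F"
    by (auto simp: abstract_faces_def simplices_def)
  then show "W \<in> {G. \<exists>F\<in>M. G \<subseteq> F}"
    using vertices_convex_hull by auto
next
  fix G assume "G \<in> {G. \<exists>F\<in>M. G \<subseteq> F}"
  then obtain F where F: "F \<in> M" "G \<subseteq> F"
    by auto
  then have "convex hull G \<in> simplices"
    by (auto simp: simplices_def)
  then show "G \<in> abstract_faces simplices"
    using vertices_convex_hull[OF F] unfolding abstract_faces_def by force
qed

text \<open>A minimal non-face that does not have two elements contains each of its two-element
  subsets properly, so these are faces; the clique hypothesis then makes it a face after
  all.\<close>

lemma flag_triangulation_simplices:
  assumes flag: "\<And>W. W \<subseteq> \<Union>M \<Longrightarrow> (\<And>p q. p \<in> W \<Longrightarrow> q \<in> W \<Longrightarrow> \<exists>F\<in>M. {p, q} \<subseteq> F) \<Longrightarrow> \<exists>F\<in>M. W \<subseteq> F"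
  shows "flag_triangulation simplices"
  unfolding flag_triangulation_def
proof (intro allI impI)
  fix W assume "minimal_nonface simplices W"
  moreover have "\<Union>(abstract_faces simplices) = \<Union>M"
    unfolding abstract_faces_simplices by blast
  ultimately have W: "W \<subseteq> \<Union>M" "\<not> (\<exists>F\<in>M. W \<subseteq> F)" "\<And>W'. W' \<subset> W \<Longrightarrow> \<exists>F\<in>M. W' \<subseteq> F"
    unfolding minimal_nonface_def by (simp_all add: abstract_faces_simplices)
  show "card W = 2"
  proof (rule ccontr)
    assume card: "card W \<noteq> 2"
    have "\<exists>F\<in>M. {p, q} \<subseteq> F" if pq: "p \<in> W" "q \<in> W" for p q
    proof (cases "p = q")
      case True
      moreover obtain F where "F \<in> M" "p \<in> F"
        using W(1) pq(1) by auto
      ultimately show ?thesis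
        by auto
    next
      case False
      then have "{p, q} \<noteq> W"
        using card by auto
      then show ?thesis
        using W(3)[of "{p, q}"] pq by blast
    qed
    then show False
      using flag[OF W(1)] W(2) by blast
  qed
qed

end

section \<open>Staircases\<close>

locale staircase =
  fixes u :: "'a \<Rightarrow> nat" and \<tau> :: "nat \<Rightarrow> 'a \<Rightarrow> nat"
  assumes u_pos: "1 \<le> u q"
    and \<tau>_strict_mono: "j < k \<Longrightarrow> \<tau> j q < \<tau> k q"
begin

text \<open>
  The clock value \<open>\<tau> j q\<close> is the time at which the vertex above \<open>q\<close> is raised from height \<open>j\<close> to
  \<open>j + 1\<close>, and \<open>K t q\<close> is its height just before time \<open>t\<close>.
\<close>

definition K :: "nat \<Rightarrow> 'a \<Rightarrow> nat" where
  "K t q = (LEAST k. 1 \<le> k \<and> (k < u q \<longrightarrow> t \<le> \<tau> k q))"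

lemma K_ge_1: "1 \<le> K t q"
  and less_K: "\<lbrakk>1 \<le> j; j < K t q\<rbrakk> \<Longrightarrow> \<tau> j q < t"
  and K_le: "K t q \<le> u q"
  and K_le_time: "\<lbrakk>K t q \<le> j; j < u q\<rbrakk> \<Longrightarrow> t \<le> \<tau> j q"
proof -
  let ?P = "\<lambda>k. 1 \<le> k \<and> (k < u q \<longrightarrow> t \<le> \<tau> k q)"
  \<comment> \<open>The top height always qualifies, so the minimum exists and never exceeds
    \<open>u q\<close>.\<close>
  have "?P (u q)"
    using u_pos by simp
  then have K: "?P (K t q)" "K t q \<le> u q"
    unfolding K_def by (rule LeastI, rule Least_le)
  show "1 \<le> K t q" "K t q \<le> u q"
    using K by auto
  show "\<tau> j q < t" if "1 \<le> j" "j < K t q"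
    using not_less_Least[of j ?P] that unfolding K_def by auto
  show "t \<le> \<tau> j q" if "K t q \<le> j" "j < u q"
    using K(1) \<tau>_strict_mono[of "K t q" j q] that by (cases "K t q = j") auto
qed

lemma K_eqI:
  assumes "1 \<le> k" "k \<le> u q" "\<And>j. \<lbrakk>1 \<le> j; j < k\<rbrakk> \<Longrightarrow> \<tau> j q < t" "k < u q \<Longrightarrow> t \<le> \<tau> k q"
  shows "K t q = k"
proof (rule antisym; rule ccontr)
  assume "\<not> K t q \<le> k"
  then show False
    using less_K[of k t q] assms K_le[of t q] by auto
next
  assume "\<not> k \<le> K t q"
  then show False
    using assms(3)[of "K t q"] assms(2) K_ge_1[of t q] K_le_time[of t q "K t q"] by auto
qed

lemma K_0: "K 0 q = 1"
  using u_pos by (intro K_eqI) auto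

lemma K_top: "\<tau> (u q) q < t \<Longrightarrow> K t q = u q"
  using u_pos \<tau>_strict_mono[of _ "u q" q] less_trans by (intro K_eqI) blast+

text \<open>After a raise at time \<open>t\<close> the next clock value lies beyond \<open>t\<close>
  by strict monotonicity, so a vertex moves by at most one unit.\<close>

lemma K_Suc: "K (Suc t) q = (if K t q < u q \<and> \<tau> (K t q) q = t then Suc (K t q) else K t q)"
proof (cases "K t q < u q \<and> \<tau> (K t q) q = t")
  case True
  have "K (Suc t) q = Suc (K t q)"
  proof (rule K_eqI)
    show "\<tau> j q < Suc t" if "1 \<le> j" "j < Suc (K t q)" for j
      using less_K[of j t q] that True by (cases "j = K t q") auto
    show "Suc t \<le> \<tau> (Suc (K t q)) q"
      using True \<tau>_strict_mono[of "K t q" "Suc (K t q)" q] by simp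
  qed (use True in auto)
  then show ?thesis
    using True by simp
next
  case False
  have "K (Suc t) q = K t q"
    using False less_K[of _ t q] K_le_time[of t q "K t q"] K_ge_1 K_le
    by (intro K_eqI) (auto simp: less_Suc_eq dest: le_neq_implies_less)
  then show ?thesis
    using False by simp
qed

text \<open>The lifetime of the point at height \<open>k\<close> is the closed interval from
  \<open>\<tau> (k - 1) q\<close> to \<open>\<tau> k q\<close>, unbounded on the left at the floor
  and on the right at the top. Both endpoints count because a cell contains the layers before and
  after its event. Flagness rests on this interval form.\<close>

lemma alive_iff:
  "k = K t q \<or> k = K (Suc t) q \<longleftrightarrow>
   1 \<le> k \<and> k \<le> u q \<and> (1 < k \<longrightarrow> \<tau> (k - 1) q \<le> t) \<and> (k < u q \<longrightarrow> t \<le> \<tau> k q)"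
    (is "?lhs \<longleftrightarrow> ?rhs")
proof
  assume ?lhs
  then consider "k = K t q" | "k = Suc (K t q)" "K t q < u q" "\<tau> (K t q) q = t"
    using K_Suc[of t q] by presburger
  then show ?rhs
  proof cases
    case 1
    have "1 < k \<Longrightarrow> \<tau> (k - 1) q < t"
      using less_K[of "k - 1" t q] 1 by simp
    then show ?thesis
      using K_ge_1[of t q] K_le[of t q] K_le_time[of t q k] 1 by auto
  next
    case 2
    then show ?thesis
      using K_ge_1[of t q] \<tau>_strict_mono[of "K t q" k q] by auto
  qed
next
  assume r: ?rhs
  show ?lhs
  proof (cases "1 < k \<and> \<tau> (k - 1) q = t")
    case True
    then have "K t q = k - 1"
      using r \<tau>_strict_mono[of _ "k - 1" q] by (intro K_eqI) auto
    then show ?thesis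
      using True r by (auto simp: K_Suc)
  next
    case False
    have "\<tau> j q < t" if "1 \<le> j" "j < k" for j
    proof -
      have "\<tau> (k - 1) q < t"
        using r False that by linarith
      moreover have "j = k - 1 \<or> j < k - 1"
        using that by linarith
      ultimately show ?thesis
        using \<tau>_strict_mono[of j "k - 1" q] by auto
    qed
    then have "K t q = k"
      using r by (intro K_eqI) auto
    then show ?thesis
      by simp
  qed
qed

text \<open>A discrete convex function of the height: its slope from \<open>j\<close> to
  \<open>j + 1\<close> is the clock value \<open>\<tau> j q\<close>, and it vanishes on the floor,
  where the sum is empty.\<close>

definition height_weight :: "'a \<Rightarrow> nat \<Rightarrow> real" where
  "height_weight q h = (\<Sum>j=1..<h. real (\<tau> j q))"

lemma height_weight_diff:
  assumes "1 \<le> h" "h \<le> k"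
  shows "height_weight q k - height_weight q h - real t * (real k - real h) = (\<Sum>j=h..<k. real (\<tau> j q) - real t)"
proof -
  have "height_weight q k = height_weight q h + (\<Sum>j=h..<k. real (\<tau> j q))"
    unfolding height_weight_def using assms by (simp add: sum.atLeastLessThan_concat)
  then show ?thesis
    using assms by (simp add: sum_subtractf of_nat_diff algebra_simps)
qed

text \<open>The line of slope \<open>t\<close> through the point at height \<open>K t q\<close>
  supports the convex function \<open>height_weight q\<close>: the slopes before that height are
  below \<open>t\<close>, the later ones are at least \<open>t\<close>. Equality occurs only for a
  raise at time \<open>t\<close> itself, so the line touches just the heights present at
  \<open>t\<close>.\<close>

lemma height_weight_support:
  assumes "1 \<le> h" "h \<le> u q"
  shows "h = K t q \<or> h = K (Suc t) q \<Longrightarrow>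
      height_weight q (K t q) + real t * (real h - real (K t q)) = height_weight q h"
    and "\<not> (h = K t q \<or> h = K (Suc t) q) \<Longrightarrow>
      height_weight q (K t q) + real t * (real h - real (K t q)) < height_weight q h"
proof -
  assume "h = K t q \<or> h = K (Suc t) q"
  then consider "h = K t q" | "h = Suc (K t q)" "\<tau> (K t q) q = t"
    using K_Suc[of t q] by presburger
  then show "height_weight q (K t q) + real t * (real h - real (K t q)) = height_weight q h"
    using height_weight_diff[of "K t q" h q t] K_ge_1[of t q] by cases auto
next
  assume na: "\<not> (h = K t q \<or> h = K (Suc t) q)"
  consider "h < K t q" | "K t q < h"
    using na by fastforce
  then show "height_weight q (K t q) + real t * (real h - real (K t q)) < height_weight q h"
  proof cases
    case 1
    have "(\<Sum>j=h..<K t q. real t - real (\<tau> j q)) > 0"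
      using 1 assms less_K[of _ t q] by (intro sum_pos) auto
    then show ?thesis
      using height_weight_diff[of h "K t q" q t] 1 assms by (simp add: sum_subtractf algebra_simps)
  next
    case 2
    \<comment> \<open>If the last slope were \<open>t\<close>, then \<open>h\<close> would be the
      height reached by the raise at time \<open>t\<close>, which is excluded. Hence the sum below
      has a strictly positive term.\<close>
    have "t \<noteq> \<tau> (h - 1) q"
    proof
      assume t: "t = \<tau> (h - 1) q"
      then have "\<not> K t q < h - 1"
        using 2 assms K_le_time[of t q "K t q"] \<tau>_strict_mono[of "K t q" "h - 1" q] by linarith
      then have "K t q = h - 1"
        using 2 by linarith
      moreover have "h - 1 < u q" "Suc (h - 1) = h"
        using assms by linarith+
      ultimately have "K (Suc t) q = h"
        using t by (simp add: K_Suc)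
      then show False
        using na by simp
    qed
    then have "t < \<tau> (h - 1) q"
      using K_le_time[of t q "h - 1"] 2 assms by linarith
    moreover have "\<And>j. j \<in> {K t q..<h} \<Longrightarrow> t \<le> \<tau> j q"
      using K_le_time[of t q] assms by auto
    ultimately have "(\<Sum>j=K t q..<h. real (\<tau> j q) - real t) > 0"
      using 2 by (intro sum_pos2[of _ "h - 1"]) auto
    then show ?thesis
      using height_weight_diff[of "K t q" h q t] 2 K_ge_1[of t q] by simp
  qed
qed

end

section \<open>Chimneys\<close>

lemma independent_inner_values:
  fixes F :: "'a::euclidean_space set"
  assumes "independent F"
  obtains a where "\<And>v. v \<in> F \<Longrightarrow> a \<bullet> v = f v"
proof -
  obtain g where g: "linear g" "\<forall>v\<in>F. g v = f v"
    using linear_independent_extend[OF assms] by blast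
  have "adjoint g 1 \<bullet> v = g v" for v
    using adjoint_works[OF g(1), of v 1] by (simp add: inner_commute)
  then show ?thesis
    using that g(2) by metis
qed

lemma group_closure_subset: "S \<subseteq> group_closure T \<Longrightarrow> group_closure S \<subseteq> group_closure T"
proof
  fix x assume S: "S \<subseteq> group_closure T" and "x \<in> group_closure S"
  from this(2) show "x \<in> group_closure T"
    by induction (use S in \<open>auto intro: group_closure.diff\<close>)
qed

lemma group_closure_of_nat_scaleR:
  fixes x :: "'a::real_vector"
  shows "x \<in> group_closure S \<Longrightarrow> real n *\<^sub>R x \<in> group_closure S"
  by (induction n) (auto simp: scaleR_left_distrib intro: group_closure_add)

lemma group_closure_subset_span: "group_closure S \<subseteq> span S"
proof
  fix x assume "x \<in> group_closure S"
  then show "x \<in> span S"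
    by induction (auto intro: span_base span_zero span_diff)
qed

lemma group_closure_eq_sum:
  fixes S :: "'a::real_vector set"
  assumes "finite S" "x \<in> group_closure S"
  obtains c :: "'a \<Rightarrow> int" where "x = (\<Sum>v\<in>S. of_int (c v) *\<^sub>R v)"
proof -
  from assms(2) have "\<exists>c :: 'a \<Rightarrow> int. x = (\<Sum>v\<in>S. of_int (c v) *\<^sub>R v)"
  proof induction
    case (base s)
    show ?case
    proof (cases "s \<in> S")
      case True
      have "(\<Sum>v\<in>S. of_int (if v = s then 1 else 0) *\<^sub>R v) = (\<Sum>v\<in>S. if v = s then v else 0)"
        by (intro sum.cong) auto
      then show ?thesis
        using True assms(1) by (intro exI[of _ "\<lambda>v. if v = s then 1 else 0"]) simp
    next
      case False
      then show ?thesis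
        using base by (intro exI[of _ "\<lambda>_. 0"]) auto
    qed
  next
    case (diff s t)
    then obtain c d where "s = (\<Sum>v\<in>S. of_int (c v) *\<^sub>R v)" "t = (\<Sum>v\<in>S. of_int (d v) *\<^sub>R v)"
      by blast
    then show ?case
      by (intro exI[of _ "\<lambda>v. c v - d v"]) (simp add: scaleR_left_diff_distrib sum_subtractf)
  qed
  then show ?thesis
    using that by blast
qed

lemma convex_cone_hull_eq_sum:
  fixes S :: "'a::real_vector set"
  assumes "finite S" "x \<in> convex_cone hull S"
  obtains c :: "'a \<Rightarrow> real" where "\<And>v. v \<in> S \<Longrightarrow> 0 \<le> c v" "x = (\<Sum>v\<in>S. c v *\<^sub>R v)"
proof (cases "x = 0")
  case True
  then show ?thesis
    using that[of "\<lambda>_. 0"] by simp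
next
  case False
  then obtain r y where y: "0 \<le> r" "y \<in> convex hull S" "x = r *\<^sub>R y"
    using assms(2) unfolding convex_cone_hull_convex_hull by blast
  then obtain d where "\<forall>v\<in>S. 0 \<le> d v" "(\<Sum>v\<in>S. d v *\<^sub>R v) = y"
    unfolding convex_hull_finite[OF assms(1)] by blast
  then show ?thesis
    using that[of "\<lambda>v. r * d v"] y by (auto simp: scaleR_sum_right)
qed

lemma sum_in_convex_cone_hull:
  assumes "\<And>i. i \<in> I \<Longrightarrow> 0 \<le> c i" "\<And>i. i \<in> I \<Longrightarrow> p i \<in> S"
  shows "(\<Sum>i\<in>I. c i *\<^sub>R p i) \<in> convex_cone hull S"
  using assms
proof (induction I rule: infinite_finite_induct)
  case (insert i I)
  then have "c i *\<^sub>R p i \<in> convex_cone hull S"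
    by (intro convex_cone_hull_mul hull_inc) auto
  then show ?case
    using insert by (simp add: convex_cone_hull_add)
qed (auto simp: convex_cone_hull_contains_0)

text \<open>The homogeneous form of the support condition of \<open>weighted_facets\<close>: all
  vertices will lie in the hyperplane \<open>x \<bullet> e = 1\<close>, on which a constant term is
  a multiple of the inner product with \<open>e\<close>.\<close>

definition supported :: "'a::real_inner set set \<Rightarrow> ('a \<Rightarrow> real) \<Rightarrow> bool" where
  "supported M w \<longleftrightarrow> (\<forall>F\<in>M. \<exists>a. (\<forall>v\<in>F. a \<bullet> v = w v) \<and> (\<forall>v\<in>\<Union>M - F. a \<bullet> v < w v))"

text \<open>Flagness in terms of vertex sets, the form in which it is passed from one dimension to
  the next.\<close>

definition clique_closed :: "'a set set \<Rightarrow> bool" where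
  "clique_closed M \<longleftrightarrow>
     (\<forall>W\<subseteq>\<Union>M. (\<forall>p\<in>W. \<forall>q\<in>W. \<exists>F\<in>M. {p, q} \<subseteq> F) \<longrightarrow> (\<exists>F\<in>M. W \<subseteq> F))"

text \<open>\<open>M\<close> is the triangulated base, \<open>b\<close> the vertical direction and
  \<open>e\<close> the apex at height zero. By \<open>\<tau>_inj\<close> no two vertices are raised
  at the same time, which keeps every cell a simplex.\<close>

locale chimney = staircase u \<tau>
  for u :: "'a::euclidean_space \<Rightarrow> nat" and \<tau> +
  fixes M :: "'a set set" and e b :: 'a
  assumes finite_M: "finite M" and M_nonempty: "M \<noteq> {}"
    and finite_facet: "F \<in> M \<Longrightarrow> finite F"
    and e_e: "e \<bullet> e = 1" and b_b: "b \<bullet> b = 1" and e_b: "e \<bullet> b = 0"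
    and q_e: "q \<in> \<Union>M \<Longrightarrow> q \<bullet> e = 1" and q_b: "q \<in> \<Union>M \<Longrightarrow> q \<bullet> b = 0"
    and \<tau>_inj: "\<lbrakk>p \<in> \<Union>M; q \<in> \<Union>M; \<tau> j p = \<tau> k q\<rbrakk> \<Longrightarrow> p = q"
begin

definition lift :: "nat \<Rightarrow> 'a \<Rightarrow> 'a" where
  "lift t q = q + real (K t q) *\<^sub>R b"

text \<open>One step of the staircase: the layers just before and just after time \<open>t\<close>.
  At an event they differ in a single vertex.\<close>

definition cell :: "'a set \<Rightarrow> nat \<Rightarrow> 'a set" where
  "cell F t = lift t ` F \<union> lift (Suc t) ` F"

definition pyramid :: "'a set \<Rightarrow> 'a set" where
  "pyramid F = insert e ((\<lambda>q. q + b) ` F)"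

text \<open>Cells are taken only at times at which a vertex of \<open>F\<close> itself is raised; at
  any other time the two layers over \<open>F\<close> coincide and the simplex would lack a
  dimension.\<close>

definition facets :: "'a set set" where
  "facets = {cell F (\<tau> j p) |F p j. F \<in> M \<and> p \<in> F \<and> 1 \<le> j \<and> j < u p} \<union> pyramid ` M"

lemma facets_cases:
  assumes "X \<in> facets"
  obtains (cell) F p j where "F \<in> M" "p \<in> F" "1 \<le> j" "j < u p" "X = cell F (\<tau> j p)"
  | (pyramid) F where "F \<in> M" "X = pyramid F"
  using assms unfolding facets_def by blast

lemma cell_in_facets: "\<lbrakk>F \<in> M; p \<in> F; 1 \<le> j; j < u p\<rbrakk> \<Longrightarrow> cell F (\<tau> j p) \<in> facets"
  unfolding facets_def by blast

lemma pyramid_in_facets: "F \<in> M \<Longrightarrow> pyramid F \<in> facets"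
  unfolding facets_def by blast

section \<open>Base point and height as coordinates of the vertices\<close>

lemma add_scaleR_eq_iff:
  assumes "p \<in> \<Union>M" "q \<in> \<Union>M"
  shows "p + x *\<^sub>R b = q + y *\<^sub>R b \<longleftrightarrow> p = q \<and> x = y"
proof
  assume eq: "p + x *\<^sub>R b = q + y *\<^sub>R b"
  then have "(p + x *\<^sub>R b) \<bullet> b = (q + y *\<^sub>R b) \<bullet> b"
    by simp
  then have "x = y"
    using q_b assms by (simp add: inner_add_left b_b)
  then show "p = q \<and> x = y"
    using eq by simp
qed auto

lemma add_neq_e: "q \<in> \<Union>M \<Longrightarrow> x \<noteq> 0 \<Longrightarrow> q + x *\<^sub>R b \<noteq> e"
proof
  assume "q \<in> \<Union>M" "x \<noteq> 0" "q + x *\<^sub>R b = e"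
  then have "(q + x *\<^sub>R b) \<bullet> b = e \<bullet> b"
    by simp
  then show False
    using \<open>x \<noteq> 0\<close> q_b[OF \<open>q \<in> \<Union>M\<close>] by (simp add: inner_add_left b_b e_b)
qed

lemma mem_cell_iff:
  assumes "F \<in> M" "q \<in> \<Union>M"
  shows "q + real h *\<^sub>R b \<in> cell F t \<longleftrightarrow> q \<in> F \<and> (h = K t q \<or> h = K (Suc t) q)"
proof -
  have "q + real h *\<^sub>R b \<in> lift s ` F \<longleftrightarrow> q \<in> F \<and> h = K s q" for s
    unfolding lift_def image_iff using add_scaleR_eq_iff[OF assms(2)] assms(1)
    by (metis UnionI of_nat_eq_iff)
  then show ?thesis
    unfolding cell_def by auto
qed

lemma mem_pyramid_iff:
  assumes "F \<in> M" "q \<in> \<Union>M" "1 \<le> h"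
  shows "q + real h *\<^sub>R b \<in> pyramid F \<longleftrightarrow> q \<in> F \<and> h = 1"
proof -
  have "q + real h *\<^sub>R b \<in> (\<lambda>q. q + b) ` F \<longleftrightarrow> q \<in> F \<and> h = 1"
    unfolding image_iff using add_scaleR_eq_iff[OF assms(2), of _ "real h" 1] assms(1)
    by (metis UnionI of_nat_eq_1_iff scaleR_one)
  then show ?thesis
    using add_neq_e[OF assms(2), of "real h"] assms(3) by (auto simp: pyramid_def)
qed

lemma vertex_cases:
  assumes "v \<in> \<Union>facets"
  obtains "v = e" | q h where "q \<in> \<Union>M" "1 \<le> h" "h \<le> u q" "v = q + real h *\<^sub>R b"
proof -
  obtain X where "X \<in> facets" "v \<in> X"
    using assms by blast
  then show ?thesis
  proof (cases rule: facets_cases)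
    case (cell F p j)
    then obtain t q where "q \<in> F" "v = lift t q"
      using \<open>v \<in> X\<close> by (auto simp: cell_def)
    then show ?thesis
      using that(2)[of q "K t q"] cell K_ge_1 K_le by (auto simp: lift_def)
  next
    case (pyramid F)
    then consider "v = e" | q where "q \<in> F" "v = q + b"
      using \<open>v \<in> X\<close> by (auto simp: pyramid_def)
    then show ?thesis
    proof cases
      case 2
      then show ?thesis
        using that(2)[of q 1] pyramid u_pos by auto
    qed (use that(1) in auto)
  qed
qed

lemma e_notin_cell: "F \<in> M \<Longrightarrow> e \<notin> cell F t"
proof
  assume F: "F \<in> M" and "e \<in> cell F t"
  then obtain s q where q: "q \<in> F" "e = q + real (K s q) *\<^sub>R b"
    unfolding cell_def lift_def by blast
  moreover have "real (K s q) \<noteq> 0"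
    using K_ge_1[of s q] by linarith
  ultimately show False
    using add_neq_e[of q "real (K s q)"] F by auto
qed

text \<open>The time \<open>\<tau> j p\<close> is an event of \<open>p\<close> alone by
  \<open>\<tau>_inj\<close>, so the other vertices keep their heights.\<close>

lemma K_Suc_event:
  assumes "F \<in> M" "p \<in> F" "1 \<le> j" "j < u p" "q \<in> F"
  shows "K (Suc (\<tau> j p)) q = (if q = p then Suc (K (\<tau> j p) q) else K (\<tau> j p) q)"
proof -
  have "K (\<tau> j p) p = j"
    using assms \<tau>_strict_mono by (intro K_eqI) auto
  moreover have "\<tau> k q = \<tau> j p \<Longrightarrow> q = p" for k
    using \<tau>_inj[of q p k j] assms by blast
  ultimately show ?thesis
    using assms by (auto simp: K_Suc)
qed

lemma cell_event:
  assumes "F \<in> M" "p \<in> F" "1 \<le> j" "j < u p"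
  shows "cell F (\<tau> j p) = insert (lift (\<tau> j p) p + b) (lift (\<tau> j p) ` F)"
proof -
  have "lift (Suc (\<tau> j p)) q = (if q = p then lift (\<tau> j p) p + b else lift (\<tau> j p) q)" if "q \<in> F" for q
    using K_Suc_event[OF assms that] by (auto simp: lift_def scaleR_left_distrib)
  then have "lift (Suc (\<tau> j p)) ` F \<subseteq> insert (lift (\<tau> j p) p + b) (lift (\<tau> j p) ` F)"
      and "lift (\<tau> j p) p + b \<in> lift (Suc (\<tau> j p)) ` F"
    using assms(2) by (auto simp: image_iff split: if_splits)
  then show ?thesis
    unfolding cell_def by blast
qed

section \<open>Finiteness, size and lattice generation\<close>

lemma finite_facets_members: "X \<in> facets \<Longrightarrow> finite X"
  using finite_facet by (auto elim!: facets_cases simp: cell_def pyramid_def)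

lemma finite_facets: "finite facets"
proof -
  have "facets \<subseteq> (\<Union>F\<in>M. \<Union>p\<in>F. (\<lambda>j. cell F (\<tau> j p)) ` {..<u p}) \<union> pyramid ` M"
    unfolding facets_def by blast
  moreover have "finite \<dots>"
    using finite_M finite_facet by auto
  ultimately show ?thesis
    using finite_subset by blast
qed

lemma facets_nonempty: "facets \<noteq> {}"
  using M_nonempty pyramid_in_facets by blast

text \<open>An upper bound suffices for the induction: a set of this size that generates the lattice
  is independent by a dimension count.\<close>

lemma card_facets:
  assumes "\<And>F. F \<in> M \<Longrightarrow> card F \<le> m" "X \<in> facets"
  shows "card X \<le> Suc m"
  using assms(2)
proof (cases rule: facets_cases)
  case (cell F p j)
  have "card X \<le> Suc (card (lift (\<tau> j p) ` F))"
    using cell cell_event by (simp add: card_insert_le_m1 finite_facet card_insert_if)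
  also have "\<dots> \<le> Suc (card F)"
    using card_image_le finite_facet cell by auto
  finally show ?thesis
    using assms(1)[OF cell(1)] by simp
next
  case (pyramid F)
  have "card X \<le> Suc (card ((\<lambda>q. q + b) ` F))"
    using pyramid by (simp add: pyramid_def finite_facet card_insert_if)
  also have "\<dots> \<le> Suc (card F)"
    using card_image_le finite_facet pyramid by auto
  finally show ?thesis
    using assms(1)[OF pyramid(1)] by simp
qed

text \<open>The homomorphism sending \<open>x\<close> to
  \<open>x + (x \<bullet> e) *\<^sub>R b\<close> takes the vertices of \<open>F\<close> to the
  floor, so the floor generates \<open>e + b\<close>; subtracting the apex leaves
  \<open>b\<close>.\<close>

lemma b_in_group_closure_pyramid:
  assumes "F \<in> M" "e \<in> group_closure F"
  shows "b \<in> group_closure (pyramid F)"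
proof -
  have "x + (x \<bullet> e) *\<^sub>R b \<in> group_closure (pyramid F)" if "x \<in> group_closure F" for x
    using that
  proof induction
    case (base s)
    show ?case
    proof (cases "s \<in> F")
      case True
      then have "s \<bullet> e = 1"
        using q_e assms(1) by blast
      then have "s + (s \<bullet> e) *\<^sub>R b \<in> pyramid F"
        using True by (auto simp: pyramid_def)
      then show ?thesis
        by (simp add: group_closure.base)
    qed (use base in simp)
  next
    case (diff s t)
    have eq: "s - t + ((s - t) \<bullet> e) *\<^sub>R b = (s + (s \<bullet> e) *\<^sub>R b) - (t + (t \<bullet> e) *\<^sub>R b)"
      by (simp add: inner_diff_left scaleR_left_diff_distrib)
    then show ?case
      unfolding eq using diff by (intro group_closure.diff)
  qed
  from this[OF assms(2)] have "e + b \<in> group_closure (pyramid F)"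
    by (simp add: e_e)
  moreover have "e \<in> group_closure (pyramid F)"
    by (auto simp: pyramid_def intro: group_closure.base)
  ultimately show ?thesis
    using group_closure.diff[of "e + b" "pyramid F" e] by simp
qed

text \<open>First \<open>b\<close> is generated: in a cell as the difference of the two positions of
  the raised vertex, in a pyramid by \<open>b_in_group_closure_pyramid\<close>. Subtracting integer
  multiples of \<open>b\<close> then recovers the vertices of the base.\<close>

lemma group_closure_facets:
  assumes S: "\<And>F. F \<in> M \<Longrightarrow> S \<subseteq> group_closure F" and e: "e \<in> S" and X: "X \<in> facets"
  shows "insert b S \<subseteq> group_closure X"
proof -
  obtain F where F: "F \<in> M" "b \<in> group_closure X" "F \<subseteq> group_closure X"
    using X
  proof (cases rule: facets_cases)
    case (cell F p j)
    have b: "b \<in> group_closure X"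
      using group_closure.diff[of "lift (\<tau> j p) p + b" X "lift (\<tau> j p) p"] cell cell_event
      by (simp add: group_closure.base)
    have "lift (\<tau> j p) q - real (K (\<tau> j p) q) *\<^sub>R b \<in> group_closure X" if "q \<in> F" for q
      using that cell by (intro group_closure.diff group_closure_of_nat_scaleR b group_closure.base) (auto simp: cell_def)
    then show ?thesis
      using that[OF cell(1) b] by (auto simp: lift_def)
  next
    case (pyramid F)
    have b: "b \<in> group_closure X"
      using pyramid S e b_in_group_closure_pyramid by blast
    have "q + b - b \<in> group_closure X" if "q \<in> F" for q
      using that pyramid by (intro group_closure.diff b group_closure.base) (auto simp: pyramid_def)
    then show ?thesis
      using that[OF pyramid(1) b] by auto
  qed
  then show ?thesis
    using S[OF F(1)] group_closure_subset[OF F(3)] by blast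
qed

end

section \<open>Support by the lifted weights\<close>

context chimney
begin

text \<open>The left vector acts on the base like \<open>a\<close> but has vertical slope
  \<open>s\<close>; the supporting functionals below are all of this shape.\<close>

lemma inner_lifted:
  assumes "q \<in> \<Union>M"
  shows "(a + (s - a \<bullet> b) *\<^sub>R b) \<bullet> (q + h *\<^sub>R b) = a \<bullet> q + s * h"
  using q_b[OF assms] by (simp add: inner_commute[of b q] inner_left_distrib inner_right_distrib b_b algebra_simps)

lemma inner_lifted_e: "(a + (s - a \<bullet> b) *\<^sub>R b) \<bullet> e = a \<bullet> e"
  by (simp add: inner_left_distrib inner_commute[of b e] e_b)

text \<open>Base point and height of a vertex are recovered from \<open>v \<bullet> b\<close>;
  heights of vertices are integers, so the rounding is exact.\<close>

definition lifted_weight :: "('a \<Rightarrow> real) \<Rightarrow> real \<Rightarrow> real \<Rightarrow> 'a \<Rightarrow> real" where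
  "lifted_weight w L H v = (if v = e then H
     else L * w (v - (v \<bullet> b) *\<^sub>R b) + height_weight (v - (v \<bullet> b) *\<^sub>R b) (nat \<lfloor>v \<bullet> b\<rfloor>))"

lemma lifted_weight_e: "lifted_weight w L H e = H"
  by (simp add: lifted_weight_def)

lemma lifted_weight_vertex:
  assumes "q \<in> \<Union>M" "1 \<le> h"
  shows "lifted_weight w L H (q + real h *\<^sub>R b) = L * w q + height_weight q h"
proof -
  have "(q + real h *\<^sub>R b) \<bullet> b = real h"
    using q_b[OF assms(1)] by (simp add: inner_left_distrib b_b)
  then show ?thesis
    using add_neq_e[OF assms(1), of "real h"] assms(2) by (simp add: lifted_weight_def)
qed

lemma height_weight_nonneg: "0 \<le> height_weight q h"
  by (simp add: height_weight_def sum_nonneg)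

lemma eventually_less_mult:
  fixes A d :: real
  assumes "0 < d"
  shows "\<forall>\<^sub>F L in at_top. A < L * d"
  using eventually_gt_at_top[of "A / d"] by eventually_elim (use assms in \<open>simp add: pos_divide_less_eq\<close>)

text \<open>For a cell, \<open>L\<close> outweighs the clock terms of the vertices not above
  \<open>F\<close>, \<open>height_weight_support\<close> treats those above \<open>F\<close>, and
  \<open>H\<close> has to clear the apex. For a pyramid, a large \<open>H\<close> makes the vertical
  slope negative, which pushes the functional below all points above the floor. The threshold for
  \<open>H\<close> depends on \<open>L\<close>.\<close>

lemma eventually_supported:
  assumes w: "supported M w" and ind: "\<And>F. F \<in> M \<Longrightarrow> independent F" and X: "X \<in> facets"
  shows "\<forall>\<^sub>F L in at_top. \<forall>\<^sub>F H in at_top. \<exists>a. (\<forall>v\<in>X. a \<bullet> v = lifted_weight w L H v) \<and>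
    (\<forall>v\<in>\<Union>facets - X. a \<bullet> v < lifted_weight w L H v)"
  using X
proof (cases rule: facets_cases)
  case (cell F p j)
  define t where "t = \<tau> j p"
  obtain a where a: "\<And>v. v \<in> F \<Longrightarrow> a \<bullet> v = w v" "\<And>v. v \<in> \<Union>M - F \<Longrightarrow> a \<bullet> v < w v"
    using bspec[OF w[unfolded supported_def] cell(1)] by blast
  \<comment> \<open>Independence of \<open>F\<close> permits this correction: with vertical slope
    \<open>t\<close> added, \<open>c\<close> contributes exactly
    \<open>height_weight q (K t q)\<close> at each \<open>lift t q\<close>.\<close>
  obtain c where c: "\<And>q. q \<in> F \<Longrightarrow> c \<bullet> q = height_weight q (K t q) - real t * real (K t q)"
    by (rule independent_inner_values[OF ind[OF cell(1)],
          of "\<lambda>q. height_weight q (K t q) - real t * real (K t q)"]) blast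
  have "\<forall>\<^sub>F L in at_top. \<forall>q\<in>\<Union>M - F. \<forall>h\<in>{1..u q}.
      c \<bullet> q + real t * real h - height_weight q h < L * (w q - a \<bullet> q)"
    using finite_M finite_facet a(2)
    by (intro eventually_ball_finite ballI eventually_less_mult) auto
  then show ?thesis
  proof eventually_elim
    case (elim L)
    note L = this
    show ?case
      \<comment> \<open>This bound is the value of the functional at the apex.\<close>
      using eventually_gt_at_top[of "(L *\<^sub>R a + c) \<bullet> e"]
    proof eventually_elim
      case (elim H)
      define a' where "a' = (L *\<^sub>R a + c) + (real t - (L *\<^sub>R a + c) \<bullet> b) *\<^sub>R b"
      have "(v \<in> X \<longrightarrow> a' \<bullet> v = lifted_weight w L H v) \<and> (v \<notin> X \<longrightarrow> a' \<bullet> v < lifted_weight w L H v)"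
        if "v \<in> \<Union>facets" for v
        using that
      proof (cases rule: vertex_cases)
        case 1
        then show ?thesis
          using elim e_notin_cell[OF cell(1)] cell(5) by (simp add: a'_def inner_lifted_e lifted_weight_e)
      next
        case (2 q h)
        have v: "lifted_weight w L H v = L * w q + height_weight q h"
            "a' \<bullet> v = L * (a \<bullet> q) + c \<bullet> q + real t * real h"
          unfolding a'_def 2(4) inner_lifted[OF 2(1)]
          using lifted_weight_vertex[OF 2(1,2)] by (simp_all add: inner_left_distrib)
        have mem: "v \<in> X \<longleftrightarrow> q \<in> F \<and> (h = K t q \<or> h = K (Suc t) q)"
          using mem_cell_iff[OF cell(1) 2(1)] 2(4) cell(5) t_def by simp
        show ?thesis
        proof (cases "q \<in> F")
          case True
          have "a' \<bullet> v = L * w q + (height_weight q (K t q) + real t * (real h - real (K t q)))"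
            using v(2) c[OF True] a(1)[OF True] by (simp add: algebra_simps)
          then show ?thesis
            using height_weight_support[OF 2(2,3), of t] v(1) mem True by auto
        next
          case False
          then show ?thesis
            using bspec[OF bspec[OF L, of q], of h] 2 v mem by (simp add: algebra_simps)
        qed
      qed
      then show ?case
        using X by blast
    qed
  qed
next
  case (pyramid F)
  obtain a where a: "\<And>v. v \<in> F \<Longrightarrow> a \<bullet> v = w v" "\<And>v. v \<in> \<Union>M - F \<Longrightarrow> a \<bullet> v < w v"
    using bspec[OF w[unfolded supported_def] pyramid(1)] by blast
  show ?thesis
    using eventually_gt_at_top[of 0]
  proof eventually_elim
    case (elim L)
    then have L: "0 < L" .
    show ?case
      using eventually_gt_at_top[of "L * (a \<bullet> e)"]
    proof eventually_elim
      case (elim H)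
      \<comment> \<open>\<open>s\<close> solves \<open>a' \<bullet> e = H\<close>. The term
        \<open>- s *\<^sub>R e\<close> in \<open>a'\<close> cancels the slope at height one, so the
        floor keeps the values \<open>L * (a \<bullet> q)\<close>.\<close>
      define s where "s = L * (a \<bullet> e) - H"
      have s: "s < 0"
        using elim by (simp add: s_def)
      define a' where "a' = (L *\<^sub>R a - s *\<^sub>R e) + (s - (L *\<^sub>R a - s *\<^sub>R e) \<bullet> b) *\<^sub>R b"
      have "(v \<in> X \<longrightarrow> a' \<bullet> v = lifted_weight w L H v) \<and> (v \<notin> X \<longrightarrow> a' \<bullet> v < lifted_weight w L H v)"
        if "v \<in> \<Union>facets" for v
        using that
      proof (cases rule: vertex_cases)
        case 1
        have "a' \<bullet> e = H"
          unfolding a'_def inner_lifted_e by (simp add: inner_diff_left e_e s_def)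
        then show ?thesis
          using 1 pyramid(2) by (simp add: pyramid_def lifted_weight_e)
      next
        case (2 q h)
        have "e \<bullet> q = 1"
          using q_e[OF 2(1)] by (simp add: inner_commute)
        then have v: "lifted_weight w L H v = L * w q + height_weight q h"
            "a' \<bullet> v = L * (a \<bullet> q) + s * (real h - 1)"
          unfolding a'_def 2(4) inner_lifted[OF 2(1)]
          using lifted_weight_vertex[OF 2(1,2)] by (simp_all add: inner_diff_left algebra_simps)
        have mem: "v \<in> X \<longleftrightarrow> q \<in> F \<and> h = 1"
          using mem_pyramid_iff[OF pyramid(1) 2(1,2)] 2(4) pyramid(2) by simp
        have le: "L * (a \<bullet> q) \<le> L * w q" "q \<notin> F \<Longrightarrow> L * (a \<bullet> q) < L * w q"
          using L a(1)[of q] a(2)[of q] 2(1) by (cases "q \<in> F"; simp)+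
        have "s * (real h - 1) \<le> 0" "h \<noteq> 1 \<Longrightarrow> s * (real h - 1) < 0"
          using s 2(2) by (auto simp: mult_le_0_iff mult_less_0_iff)
        then show ?thesis
          using le v mem height_weight_nonneg[of q h] a(1)[of q]
          by (cases "h = 1") (auto simp: height_weight_def)
      qed
      then show ?case
        using X by blast
    qed
  qed
qed

lemma supported_facets:
  assumes "supported M w" "\<And>F. F \<in> M \<Longrightarrow> independent F"
  obtains w' where "supported facets w'"
proof -
  have "\<forall>\<^sub>F L in at_top. \<forall>X\<in>facets. \<forall>\<^sub>F H in at_top. \<exists>a. (\<forall>v\<in>X. a \<bullet> v = lifted_weight w L H v) \<and>
    (\<forall>v\<in>\<Union>facets - X. a \<bullet> v < lifted_weight w L H v)"
    using eventually_supported[OF assms] by (intro eventually_ball_finite finite_facets) blast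
  then obtain L where "\<forall>X\<in>facets. \<forall>\<^sub>F H in at_top. \<exists>a. (\<forall>v\<in>X. a \<bullet> v = lifted_weight w L H v) \<and>
    (\<forall>v\<in>\<Union>facets - X. a \<bullet> v < lifted_weight w L H v)"
    using eventually_happens'[OF trivial_limit_at_top_linorder] by blast
  then have "\<forall>\<^sub>F H in at_top. \<forall>X\<in>facets. \<exists>a. (\<forall>v\<in>X. a \<bullet> v = lifted_weight w L H v) \<and>
    (\<forall>v\<in>\<Union>facets - X. a \<bullet> v < lifted_weight w L H v)"
    by (intro eventually_ball_finite finite_facets)
  then obtain H where "supported facets (lifted_weight w L H)"
    using eventually_happens'[OF trivial_limit_at_top_linorder] unfolding supported_def by blast
  then show ?thesis
    using that by blast
qed

section \<open>Covering by cells and pyramids\<close>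

lemma cover_pyramid:
  assumes "F \<in> M" "\<And>q. q \<in> F \<Longrightarrow> 0 \<le> c q" "0 \<le> s"
  shows "s *\<^sub>R e + (\<Sum>q\<in>F. c q *\<^sub>R (q + b)) \<in> convex_cone hull (pyramid F)"
  using assms by (intro convex_cone_hull_add convex_cone_hull_mul sum_in_convex_cone_hull hull_inc)
    (auto simp: pyramid_def)

text \<open>\<open>Y t\<close> in the proof is the height of the layer at time \<open>t\<close> over
  the base point with coefficients \<open>c\<close>. It grows from the floor to the roof, so
  \<open>y\<close> is either on the floor or between two consecutive layers, which bound a
  cell.\<close>

lemma cover_chimney:
  assumes F: "F \<in> M" and c: "\<And>q. q \<in> F \<Longrightarrow> 0 \<le> c q"
    and y: "sum c F \<le> y" "y \<le> (\<Sum>q\<in>F. c q * real (u q))"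
  shows "\<exists>X\<in>facets. (\<Sum>q\<in>F. c q *\<^sub>R q) + y *\<^sub>R b \<in> convex_cone hull X"
proof -
  define Y where "Y = (\<lambda>t. \<Sum>q\<in>F. c q * real (K t q))"
  have Y_0: "Y 0 = sum c F"
    by (simp add: Y_def K_0)
  \<comment> \<open>A time after all events, when every vertex of \<open>F\<close> has reached its
    top.\<close>
  define T where "T = Suc (\<Sum>q\<in>F. \<tau> (u q) q)"
  have "K T q = u q" if "q \<in> F" for q
    using member_le_sum[OF that, of "\<lambda>q. \<tau> (u q) q"] finite_facet[OF F]
    by (intro K_top) (auto simp: T_def)
  then have "y \<le> Y T"
    using y by (simp add: Y_def)
  define t' where "t' = (LEAST t. y \<le> Y t)"
  have t': "y \<le> Y t'"
    unfolding t'_def using \<open>y \<le> Y T\<close> by (rule LeastI)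
  have less_t': "Y t < y" if "t < t'" for t
    using not_less_Least[of t "\<lambda>t. y \<le> Y t"] that by (simp add: t'_def)
  show ?thesis
  proof (cases t')
    case 0
    then have "y = sum c F"
      using t' y Y_0 by simp
    \<comment> \<open>On the floor the point belongs to the pyramid, with coefficient zero at the
      apex.\<close>
    then have "(\<Sum>q\<in>F. c q *\<^sub>R q) + y *\<^sub>R b = 0 *\<^sub>R e + (\<Sum>q\<in>F. c q *\<^sub>R (q + b))"
      by (simp add: scaleR_right_distrib sum.distrib scaleR_sum_left)
    then show ?thesis
      using cover_pyramid[of F c 0] F c pyramid_in_facets by fastforce
  next
    case (Suc t)
    then have Yt: "Y t < y" "y \<le> Y (Suc t)"
      using t' less_t' by auto
    have "\<exists>p\<in>F. K t p \<noteq> K (Suc t) p"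
    proof (rule ccontr)
      assume "\<not> ?thesis"
      then have "Y t = Y (Suc t)"
        unfolding Y_def by (intro sum.cong) auto
      then show False
        using Yt by simp
    qed
    then obtain p where "p \<in> F" "K t p \<noteq> K (Suc t) p"
      by blast
    then have p: "p \<in> F" "K t p < u p" "t = \<tau> (K t p) p"
      using K_Suc[of t p] by (auto split: if_splits)
    have K': "K (Suc t) q = (if q = p then Suc (K t q) else K t q)" if "q \<in> F" for q
      using K_Suc_event[OF F p(1) K_ge_1 p(2) that] p(3) by simp
    have "Y (Suc t) = (\<Sum>q\<in>F. c q * real (K t q) + (if q = p then c q else 0))"
      unfolding Y_def by (intro sum.cong) (auto simp: K' algebra_simps)
    then have Y': "Y (Suc t) = Y t + c p"
      using p(1) finite_facet[OF F] by (simp add: Y_def sum.distrib)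
    \<comment> \<open>The missing height \<open>r\<close> is gained by shifting that much weight
      from \<open>lift t p\<close> to its raised copy. The weight suffices because \<open>p\<close>
      alone causes the jump from \<open>Y t\<close> to \<open>Y (Suc t)\<close>.\<close>
    define r where "r = y - Y t"
    have r: "0 \<le> r" "r \<le> c p"
      using Yt Y' by (auto simp: r_def)
    define d where "d = (\<lambda>q. c q - (if q = p then r else 0))"
    have "(\<Sum>q\<in>F. d q *\<^sub>R lift t q) = (\<Sum>q\<in>F. c q *\<^sub>R lift t q) - (\<Sum>q\<in>F. if q = p then r *\<^sub>R lift t q else 0)"
      unfolding d_def sum_subtractf[symmetric] by (intro sum.cong) (auto simp: scaleR_left_diff_distrib)
    also have "\<dots> = (\<Sum>q\<in>F. c q *\<^sub>R q) + Y t *\<^sub>R b - r *\<^sub>R lift t p"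
      using p(1) finite_facet[OF F] by (simp add: lift_def Y_def scaleR_right_distrib sum.distrib scaleR_sum_left)
    finally have "(\<Sum>q\<in>F. c q *\<^sub>R q) + y *\<^sub>R b = (\<Sum>q\<in>F. d q *\<^sub>R lift t q) + r *\<^sub>R (lift t p + b)"
      by (simp add: r_def algebra_simps)
    moreover have "(\<Sum>q\<in>F. d q *\<^sub>R lift t q) + r *\<^sub>R (lift t p + b) \<in> convex_cone hull (cell F t)"
      using r c p cell_event[OF F p(1) K_ge_1 p(2)]
      by (intro convex_cone_hull_add convex_cone_hull_mul sum_in_convex_cone_hull hull_inc)
        (auto simp: d_def)
    moreover have "cell F t \<in> facets"
      using cell_in_facets[OF F p(1) K_ge_1 p(2)] p(3) by simp
    ultimately show ?thesis
      by metis
  qed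
qed

section \<open>Cliques of vertices\<close>

lemma facet_pair:
  assumes "X \<in> facets" "q \<in> \<Union>M" "1 \<le> h" "q' \<in> \<Union>M" "1 \<le> h'"
    and "q + real h *\<^sub>R b \<in> X" "q' + real h' *\<^sub>R b \<in> X"
  shows "\<exists>F\<in>M. {q, q'} \<subseteq> F"
  using assms(1)
  by (cases rule: facets_cases) (use assms mem_cell_iff mem_pyramid_iff in auto)

text \<open>A clique projects to a clique of the base, hence into a facet \<open>F\<close>. If it
  has only floor points and the apex, the pyramid over \<open>F\<close> contains it. Otherwise let
  \<open>t\<close> be the latest birth of a point above the floor. Every member shares a cell with
  that point, so it is alive at some time not before \<open>t\<close>; being born by
  \<open>t\<close>, it is alive at \<open>t\<close> and lies in \<open>cell F t\<close>.\<close>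

lemma clique_closed_facets:
  assumes M: "clique_closed M"
  shows "clique_closed facets"
  unfolding clique_closed_def
proof (intro allI impI)
  fix W assume W: "W \<subseteq> \<Union>facets" and pairs: "\<forall>p\<in>W. \<forall>q\<in>W. \<exists>X\<in>facets. {p, q} \<subseteq> X"
  define Q where "Q = {q \<in> \<Union>M. \<exists>h\<ge>1. q + real h *\<^sub>R b \<in> W}"
  have "\<exists>F\<in>M. {q, q'} \<subseteq> F" if qq: "q \<in> Q" "q' \<in> Q" for q q'
  proof -
    obtain h where h: "1 \<le> h" "q + real h *\<^sub>R b \<in> W"
      using qq(1) unfolding Q_def by blast
    moreover obtain h' where h': "1 \<le> h'" "q' + real h' *\<^sub>R b \<in> W"
      using qq(2) unfolding Q_def by blast
    ultimately obtain X where "X \<in> facets" "q + real h *\<^sub>R b \<in> X" "q' + real h' *\<^sub>R b \<in> X"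
      using pairs by (meson insert_subset)
    then show ?thesis
      using facet_pair[of X q h q' h'] h h' qq unfolding Q_def by blast
  qed
  moreover have "Q \<subseteq> \<Union>M"
    by (auto simp: Q_def)
  ultimately obtain F where F: "F \<in> M" "Q \<subseteq> F"
    using M unfolding clique_closed_def by meson
  have W_cases: "v = e \<or> (\<exists>q h. q \<in> F \<and> 1 \<le> h \<and> h \<le> u q \<and> v = q + real h *\<^sub>R b)" if "v \<in> W" for v
  proof -
    have "v \<in> \<Union>facets"
      using W that by blast
    then show ?thesis
    proof (cases rule: vertex_cases)
      case (2 q h)
      then have "q \<in> Q"
        using that unfolding Q_def by auto
      then show ?thesis
        using F 2 by blast
    qed simp
  qed
  show "\<exists>X\<in>facets. W \<subseteq> X"
  proof (cases "\<exists>q h. q \<in> F \<and> 2 \<le> h \<and> h \<le> u q \<and> q + real h *\<^sub>R b \<in> W")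
    case nohigh: False
    have "v \<in> pyramid F" if v: "v \<in> W" for v
    proof (cases "v = e")
      case False
      then obtain q h where q: "q \<in> F" "1 \<le> h" "h \<le> u q" "v = q + real h *\<^sub>R b"
        using W_cases[OF v] by blast
      then have "h = 1"
        using nohigh v by (metis One_nat_def Suc_1 Suc_leI le_neq_implies_less)
      then show ?thesis
        using q by (auto simp: pyramid_def)
    qed (simp add: pyramid_def)
    then show ?thesis
      using pyramid_in_facets[OF F(1)] by blast
  next
    case True
    \<comment> \<open>Floor points are left out: they are present from the start and have no time of
      birth.\<close>
    define E where "E = {(q, h). q \<in> F \<and> 2 \<le> h \<and> h \<le> u q \<and> q + real h *\<^sub>R b \<in> W}"
    have "E \<subseteq> Sigma F (\<lambda>q. {..u q})"
      by (auto simp: E_def)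
    then have E: "finite E" "E \<noteq> {}"
      using True finite_facet[OF F(1)] by (auto simp: E_def intro: finite_subset)
    define f where "f = (\<lambda>(q, h). \<tau> (h - 1) q)"
    obtain z where z: "z \<in> E" "f z = Max (f ` E)"
      using Max_in[of "f ` E"] E by (metis (no_types, lifting) finite_imageI imageE image_is_empty)
    obtain p k where pk: "z = (p, k)"
      by fastforce
    define t where "t = \<tau> (k - 1) p"
    have p: "p \<in> F" "2 \<le> k" "k \<le> u p" "p + real k *\<^sub>R b \<in> W"
      using z(1) unfolding E_def pk by auto
    have max: "\<tau> (h - 1) q \<le> t" if "q \<in> F" "2 \<le> h" "h \<le> u q" "q + real h *\<^sub>R b \<in> W" for q h
    proof -
      have "f (q, h) \<le> f z"
        unfolding z(2) using E that by (intro Max_ge) (auto simp: E_def)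
      then show ?thesis
        by (simp add: f_def pk t_def)
    qed
    \<comment> \<open>A pyramid has no point of height two or more, so a facet containing the latest
      point is a cell, at a time not before its birth.\<close>
    have common: "\<exists>F'\<in>M. \<exists>s. X = cell F' s \<and> p \<in> F' \<and> \<tau> (k - 1) p \<le> s" if X: "X \<in> facets" "p + real k *\<^sub>R b \<in> X" for X
      using X(1)
    proof (cases rule: facets_cases)
      case (cell F' p' j)
      then have "p \<in> F'" "k = K (\<tau> j p') p \<or> k = K (Suc (\<tau> j p')) p"
        using X(2) mem_cell_iff[OF cell(1), of p] p F by auto
      then show ?thesis
        using alive_iff[of k "\<tau> j p'" p] p(2) cell by auto
    next
      case (pyramid F')
      then show ?thesis
        using X(2) mem_pyramid_iff[OF pyramid(1), of p k] p F by auto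
    qed
    have "v \<in> cell F t" if v: "v \<in> W" for v
    proof -
      obtain X where X: "X \<in> facets" "p + real k *\<^sub>R b \<in> X" "v \<in> X"
        using pairs p(4) v by (meson insert_subset)
      obtain F' s where s: "F' \<in> M" "X = cell F' s" "p \<in> F'" "t \<le> s"
        using common[OF X(1,2)] t_def by blast
      then have "v \<noteq> e"
        using e_notin_cell X(3) by blast
      then obtain q h where q: "q \<in> F" "1 \<le> h" "h \<le> u q" "v = q + real h *\<^sub>R b"
        using W_cases[OF v] by blast
      then have "h = K s q \<or> h = K (Suc s) q"
        using mem_cell_iff[OF s(1), of q h s] X(3) s(2) F by auto
      \<comment> \<open>Lifetimes do not depend on the facet of the base, so \<open>X\<close> yields
        this bound although it may lie above another facet \<open>F'\<close>.\<close>
      then have "h < u q \<longrightarrow> s \<le> \<tau> h q"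
        using alive_iff by blast
      then have "h = K t q \<or> h = K (Suc t) q"
        using alive_iff[of h t q] q max[of q h] v s(4) by auto
      then show ?thesis
        using mem_cell_iff[OF F(1), of q h t] q F by auto
    qed
    moreover have "cell F t \<in> facets"
      unfolding t_def using cell_in_facets[OF F(1) p(1), of "k - 1"] p by auto
    ultimately show ?thesis
      by blast
  qed
qed

end

section \<open>Lecture hall cones\<close>

text \<open>An orthonormal system in a fixed space; its initial segments are the coordinates of the
  successive stages, so the induction on the dimension never changes the type.\<close>

locale lecture_hall_frame =
  fixes e :: "'a::euclidean_space" and b :: "nat \<Rightarrow> 'a" and N :: nat
  assumes e_e: "e \<bullet> e = 1"
    and e_orth: "k \<in> {1..N} \<Longrightarrow> e \<bullet> b k = 0"
    and b_orthonormal: "\<lbrakk>j \<in> {1..N}; k \<in> {1..N}\<rbrakk> \<Longrightarrow> b j \<bullet> b k = (if j = k then 1 else 0)"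
begin

section \<open>Partial sums and the lecture hall inequalities\<close>

lemma orth_e: "k \<in> {1..N} \<Longrightarrow> b k \<bullet> e = 0"
  using e_orth by (simp add: inner_commute)

definition psum :: "nat \<Rightarrow> 'a \<Rightarrow> real" where
  "psum i x = (\<Sum>k=1..i. x \<bullet> b k)"

text \<open>The first condition confines \<open>x\<close> to the span of \<open>e\<close> and the
  first \<open>m\<close> axes. The ratio inequalities are cleared of denominators, so that the case
  \<open>i = 0\<close> is harmless.\<close>

definition lecture_hall_cone :: "nat \<Rightarrow> 'a set" where
  "lecture_hall_cone m = {x. x = (x \<bullet> e) *\<^sub>R e + (\<Sum>k=1..m. (x \<bullet> b k) *\<^sub>R b k) \<and> 0 \<le> x \<bullet> e \<and>
     (\<forall>i\<le>m. 0 \<le> psum i x) \<and> (\<forall>i<m. real (Suc i) * psum i x \<le> real i * psum (Suc i) x) \<and>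
     psum m x \<le> real m * (x \<bullet> e)}"

lemma psum_0: "psum 0 x = 0"
  and psum_Suc: "psum (Suc i) x = psum i x + x \<bullet> b (Suc i)"
  by (simp_all add: psum_def)

lemma psum_add: "psum i (x + y) = psum i x + psum i y"
  and psum_scaleR: "psum i (c *\<^sub>R x) = c * psum i x"
  by (simp_all add: psum_def inner_add_left sum.distrib sum_distrib_left)

lemma psum_sum: "psum i (\<Sum>q\<in>F. c q *\<^sub>R p q) = (\<Sum>q\<in>F. c q * psum i (p q))"
  by (induction F rule: infinite_finite_induct) (simp_all add: psum_add psum_scaleR, simp_all add: psum_def)

lemma psum_e: "i \<le> N \<Longrightarrow> psum i e = 0"
  by (simp add: psum_def e_orth)

lemma inner_b_cone:
  assumes "x \<in> lecture_hall_cone m" "m < k" "k \<le> N"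
  shows "x \<bullet> b k = 0"
proof -
  have "x \<bullet> b k = ((x \<bullet> e) *\<^sub>R e + (\<Sum>j=1..m. (x \<bullet> b j) *\<^sub>R b j)) \<bullet> b k"
    using assms(1) by (simp add: lecture_hall_cone_def)
  also have "\<dots> = (\<Sum>j=1..m. (x \<bullet> b j) * (b j \<bullet> b k))"
    using assms by (simp add: inner_add_left inner_sum_left e_orth)
  also have "\<dots> = 0"
    using assms by (intro sum.neutral) (auto simp: b_orthonormal)
  finally show ?thesis .
qed

lemma psum_add_b:
  assumes "i \<le> m" "Suc m \<le> N"
  shows "psum i (x + c *\<^sub>R b (Suc m)) = psum i x"
  unfolding psum_def using assms by (intro sum.cong) (auto simp: inner_add_left b_orthonormal)

text \<open>Above the floor this is applied with \<open>s = 0\<close>; below it, \<open>s\<close> is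
  the multiple of the apex to be split off.\<close>

lemma cone_projection:
  assumes x: "x \<in> lecture_hall_cone (Suc m)" and m: "Suc m \<le> N"
    and s: "s \<le> x \<bullet> e" "psum m x \<le> real m * (x \<bullet> e - s)"
  shows "x - (x \<bullet> b (Suc m)) *\<^sub>R b (Suc m) - s *\<^sub>R e \<in> lecture_hall_cone m"
    (is "?z \<in> _")
proof -
  have z_b: "?z \<bullet> b k = x \<bullet> b k" if "k \<in> {1..m}" for k
    using that m by (simp add: inner_diff_left e_orth b_orthonormal)
  have z_e: "?z \<bullet> e = x \<bullet> e - s"
    using m by (simp add: inner_diff_left e_e orth_e)
  have z_psum: "psum i ?z = psum i x" if "i \<le> m" for i
    using that z_b by (simp add: psum_def)
  have "?z = (?z \<bullet> e) *\<^sub>R e + (\<Sum>k=1..m. (x \<bullet> b k) *\<^sub>R b k)"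
    using x unfolding z_e by (simp add: lecture_hall_cone_def scaleR_diff_left algebra_simps)
  also have "(\<Sum>k=1..m. (x \<bullet> b k) *\<^sub>R b k) = (\<Sum>k=1..m. (?z \<bullet> b k) *\<^sub>R b k)"
    using z_b by (intro sum.cong) auto
  finally have "?z = (?z \<bullet> e) *\<^sub>R e + (\<Sum>k=1..m. (?z \<bullet> b k) *\<^sub>R b k)" .
  then show ?thesis
    using x s z_e z_psum by (auto simp: lecture_hall_cone_def)
qed

lemma e_in_cone: "m \<le> N \<Longrightarrow> e \<in> lecture_hall_cone m"
  by (simp add: lecture_hall_cone_def e_e e_orth psum_e)

text \<open>The new partial sum is \<open>psum m q + h\<close>, so the two new inequalities amount
  to \<open>psum m q \<le> m * h\<close> and \<open>h \<le> Suc m - psum m q\<close>. The first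
  follows from \<open>psum m q \<le> m\<close> and \<open>1 \<le> h\<close>.\<close>

lemma cone_lift:
  assumes q: "q \<in> lecture_hall_cone m" "q \<bullet> e = 1" and m: "Suc m \<le> N"
    and h: "1 \<le> h" "h \<le> real (Suc m) - psum m q"
  shows "q + h *\<^sub>R b (Suc m) \<in> lecture_hall_cone (Suc m)"
    (is "?z \<in> _")
proof -
  have z_b: "?z \<bullet> b k = q \<bullet> b k" if "k \<in> {1..m}" for k
    using that m by (simp add: inner_add_left b_orthonormal)
  have z_h: "?z \<bullet> b (Suc m) = h"
    using m inner_b_cone[OF q(1), of "Suc m"] by (simp add: inner_add_left b_orthonormal)
  have z_e: "?z \<bullet> e = 1"
    using m q by (simp add: inner_add_left orth_e)
  have z_psum: "psum i ?z = psum i q" if "i \<le> m" for i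
    using that m by (rule psum_add_b)
  have z_top: "psum (Suc m) ?z = psum m q + h"
    by (simp add: psum_Suc z_psum z_h)
  have "q = (q \<bullet> e) *\<^sub>R e + (\<Sum>k=1..m. (q \<bullet> b k) *\<^sub>R b k)"
    using q(1) by (simp add: lecture_hall_cone_def)
  also have "(\<Sum>k=1..m. (q \<bullet> b k) *\<^sub>R b k) = (\<Sum>k=1..m. (?z \<bullet> b k) *\<^sub>R b k)"
    using z_b by (intro sum.cong) auto
  finally have eq: "?z = (?z \<bullet> e) *\<^sub>R e + (\<Sum>k=1..Suc m. (?z \<bullet> b k) *\<^sub>R b k)"
    using z_h z_e q(2) by simp
  have q': "psum m q \<le> real m" "0 \<le> psum m q"
    using q by (auto simp: lecture_hall_cone_def)
  have "real (Suc m) * psum m q \<le> real m * (psum m q + h)"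
    using q' mult_left_mono[OF h(1), of "real m"] by (simp add: algebra_simps)
  then have "\<forall>i<Suc m. real (Suc i) * psum i ?z \<le> real i * psum (Suc i) ?z"
    using q(1) z_psum z_top by (auto simp: less_Suc_eq lecture_hall_cone_def)
  moreover have "\<forall>i\<le>Suc m. 0 \<le> psum i ?z"
    using q(1) q' h z_psum z_top by (auto simp: le_Suc_eq lecture_hall_cone_def)
  ultimately show ?thesis
    using eq z_e z_top h unfolding lecture_hall_cone_def by simp
qed

text \<open>The induction invariant, stated for the cones over the simplices: unimodularity becomes
  generation of a group, and points can be covered without normalising them. Natural coordinates
  make the roof height of the next chimney integral.\<close>

definition unimodular_fan :: "nat \<Rightarrow> 'a set set \<Rightarrow> bool" where
  "unimodular_fan m M \<longleftrightarrow> finite M \<and> M \<noteq> {} \<and>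
     (\<forall>F\<in>M. finite F \<and> card F \<le> Suc m \<and> insert e (b ` {1..m}) \<subseteq> group_closure F) \<and>
     (\<forall>q\<in>\<Union>M. q \<in> lecture_hall_cone m \<and> q \<bullet> e = 1 \<and> (\<forall>k\<in>{1..m}. q \<bullet> b k \<in> \<nat>)) \<and>
     (\<forall>x\<in>lecture_hall_cone m. \<exists>F\<in>M. x \<in> convex_cone hull F) \<and>
     clique_closed M \<and> (\<exists>w. supported M w)"

text \<open>\<open>span F\<close> contains \<open>Suc m\<close> orthonormal vectors while
  \<open>F\<close> has at most that many elements, so \<open>F\<close> is a minimal spanning
  set.\<close>

lemma unimodular_fan_independent:
  assumes M: "unimodular_fan m M" "F \<in> M" and m: "m \<le> N"
  shows "independent F" "card F = Suc m"
proof -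
  let ?B = "insert e (b ` {1..m})"
  have F: "finite F" "card F \<le> Suc m" "?B \<subseteq> span F"
    using M group_closure_subset_span unfolding unimodular_fan_def by blast+
  have inj: "inj_on b {1..m}"
    using b_orthonormal m by (intro inj_onI) (metis atLeastAtMost_iff le_trans zero_neq_one)
  have e: "e \<notin> b ` {1..m}"
    using e_orth e_e m by (metis atLeastAtMost_iff imageE le_trans zero_neq_one)
  have "pairwise orthogonal ?B"
    using e_orth orth_e b_orthonormal m by (auto simp: pairwise_def orthogonal_def)
  moreover have "b k \<noteq> 0" if "k \<in> {1..m}" for k
    using b_orthonormal[of k k] that m by auto
  then have "0 \<notin> ?B"
    using e_e by (auto simp: image_iff)
  ultimately have B: "independent ?B"
    by (rule pairwise_orthogonal_independent)
  have card_B: "card ?B = Suc m"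
    using inj e by (simp add: card_image)
  have "card ?B \<le> card F"
    using independent_span_bound[OF F(1) B F(3)] by simp
  then show card: "card F = Suc m"
    using card_B F(2) by simp
  have "card F \<le> dim (span F)"
    using independent_card_le_dim[OF F(3) B] card card_B by simp
  then show "independent F"
    using card_le_dim_spanning[of F "span F"] F(1) span_superset by blast
qed

section \<open>Induction on the dimension\<close>

lemma unimodular_fan_0: "unimodular_fan 0 {{e}}"
proof -
  have "x \<in> convex_cone hull {e}" if "x \<in> lecture_hall_cone 0" for x
  proof -
    have x: "x = (x \<bullet> e) *\<^sub>R e" "0 \<le> x \<bullet> e"
      using that by (simp_all add: lecture_hall_cone_def)
    then show ?thesis
      by (metis convex_cone_hull_mul hull_inc singletonI)
  qed
  moreover have "supported {{e}} (\<lambda>_. 0)"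
    by (auto simp: supported_def intro: exI[of _ 0])
  moreover have "e \<in> lecture_hall_cone 0"
    by (rule e_in_cone) simp
  ultimately show ?thesis
    unfolding unimodular_fan_def
    by (auto simp: clique_closed_def e_e intro: group_closure.base)
qed

lemma psum_Nats:
  assumes "\<forall>k\<in>{1..m}. q \<bullet> b k \<in> \<nat>"
  shows "psum m q \<in> \<nat>"
proof -
  have "(\<Sum>k\<in>A. q \<bullet> b k) \<in> \<nat>" if "A \<subseteq> {1..m}" for A
    using that assms by (induction A rule: infinite_finite_induct) auto
  then show ?thesis
    by (simp add: psum_def)
qed

lemma unimodular_fan_Suc:
  assumes M: "unimodular_fan m M" and m: "Suc m \<le> N"
  shows "\<exists>M'. unimodular_fan (Suc m) M'"
proof -
  define V where "V = \<Union>M"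
  have M_basic: "finite M" "M \<noteq> {}" "\<And>F. F \<in> M \<Longrightarrow> finite F" "\<And>F. F \<in> M \<Longrightarrow> card F \<le> Suc m"
      "\<And>F. F \<in> M \<Longrightarrow> insert e (b ` {1..m}) \<subseteq> group_closure F"
    using M by (auto simp: unimodular_fan_def)
  have V: "q \<in> lecture_hall_cone m" "q \<bullet> e = 1" "\<forall>k\<in>{1..m}. q \<bullet> b k \<in> \<nat>" if "q \<in> V" for q
    using M that unfolding unimodular_fan_def V_def by blast+
  \<comment> \<open>On \<open>V\<close> this is the roof given by the top inequality of the larger
    cone; outside \<open>V\<close>, the value one meets the requirement
    \<open>1 \<le> u q\<close>.\<close>
  define u where "u = (\<lambda>q. if q \<in> V then Suc m - nat \<lfloor>psum m q\<rfloor> else 1)"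
  have u: "1 \<le> u q" "real (u q) = real (Suc m) - psum m q" if q: "q \<in> V" for q
  proof -
    obtain s where s: "psum m q = real s"
      using psum_Nats[OF V(3)[OF q]] by (metis Nats_cases)
    moreover have "psum m q \<le> real m"
      using V(1,2)[OF q] by (simp add: lecture_hall_cone_def)
    ultimately show "1 \<le> u q" "real (u q) = real (Suc m) - psum m q"
      using q by (auto simp: u_def of_nat_diff)
  qed
  have "finite V"
    using M_basic by (simp add: V_def)
  then obtain r :: "'a \<Rightarrow> nat" and n where r: "r ` V = {i. i < n}" "inj_on r V"
    using finite_imp_inj_to_nat_seg by metis
  \<comment> \<open>Blocks of length \<open>Suc n\<close> make the clock increase with
    \<open>j\<close>, and the remainder \<open>r q < n\<close> identifies the vertex.\<close>
  define \<tau> where "\<tau> = (\<lambda>j q. j * Suc n + (if q \<in> V then r q else 0))"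
  interpret chimney u \<tau> M e "b (Suc m)"
  proof
    show "1 \<le> u q" for q
      using u(1)[of q] by (cases "q \<in> V") (auto simp: u_def)
    show "\<tau> j q < \<tau> k q" if "j < k" for j k q
    proof -
      have "j * Suc n < k * Suc n"
        using that by (intro mult_strict_right_mono) auto
      then show ?thesis
        by (simp add: \<tau>_def)
    qed
    show "p = q" if "p \<in> \<Union>M" "q \<in> \<Union>M" "\<tau> j p = \<tau> k q" for p q j k
    proof -
      have "p \<in> V" "q \<in> V"
        using that by (simp_all add: V_def)
      then have pq: "p \<in> V" "q \<in> V" "r p < Suc n" "r q < Suc n"
        using r(1) by (auto simp: set_eq_iff image_iff less_Suc_eq)
      then have "(j * Suc n + r p) mod Suc n = (k * Suc n + r q) mod Suc n"
        using that(3) by (simp add: \<tau>_def)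
      then have "r p = r q"
        by (simp only: mod_mult_self3 mod_less pq)
      then show ?thesis
        using r(2) pq by (simp add: inj_on_eq_iff)
    qed
    show "q \<bullet> b (Suc m) = 0" if "q \<in> \<Union>M" for q
      using inner_b_cone[OF V(1)] that m by (simp add: V_def)
  qed (use M_basic e_e e_orth b_orthonormal V(2) m V_def in auto)
  have independent: "independent F" if "F \<in> M" for F
    using unimodular_fan_independent[OF M that] m by simp
  have closure: "insert e (b ` {1..Suc m}) \<subseteq> group_closure X" if "X \<in> facets" for X
    using group_closure_facets[of "insert e (b ` {1..m})" X] M_basic(5) that
    by (simp add: atLeastAtMostSuc_conv insert_commute)
  have vertices: "v \<in> lecture_hall_cone (Suc m) \<and> v \<bullet> e = 1 \<and> (\<forall>k\<in>{1..Suc m}. v \<bullet> b k \<in> \<nat>)"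
    if "v \<in> \<Union>facets" for v
    using that
  proof (cases rule: vertex_cases)
    case 1
    then show ?thesis
      using e_in_cone e_e e_orth m by auto
  next
    case (2 q h)
    have q: "q \<in> V"
      using 2 by (simp add: V_def)
    have "real h \<le> real (Suc m) - psum m q"
      using u(2)[OF q] 2(3) by (metis of_nat_le_iff)
    then have "v \<in> lecture_hall_cone (Suc m)"
      unfolding 2(4) using V[OF q] 2 m by (intro cone_lift) auto
    moreover have "v \<bullet> e = 1"
      unfolding 2(4) using V(2)[OF q] orth_e m by (simp add: inner_add_left)
    moreover have "v \<bullet> b k \<in> \<nat>" if "k \<in> {1..Suc m}" for k
    proof (cases "k = Suc m")
      case True
      then show ?thesis
        unfolding 2(4) using inner_b_cone[OF V(1)[OF q], of k] m by (simp add: inner_add_left b_orthonormal)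
    next
      case False
      then show ?thesis
        unfolding 2(4) using V(3)[OF q] that m by (simp add: inner_add_left b_orthonormal)
    qed
    ultimately show ?thesis
      by blast
  qed
  have cover: "\<exists>X\<in>facets. x \<in> convex_cone hull X" if x: "x \<in> lecture_hall_cone (Suc m)" for x
  proof -
    define y where "y = x \<bullet> b (Suc m)"
    have psum_x: "psum (Suc m) x = psum m x + y" "0 \<le> psum m x" "0 \<le> psum (Suc m) x"
        "real (Suc m) * psum m x \<le> real m * psum (Suc m) x"
        "psum (Suc m) x \<le> real (Suc m) * (x \<bullet> e)" "0 \<le> x \<bullet> e"
      using x by (auto simp: psum_Suc y_def lecture_hall_cone_def)
    have my: "psum m x \<le> real m * y"
      using psum_x(1,4) by (simp add: algebra_simps)
    \<comment> \<open>The floor is the hyperplane \<open>y = x \<bullet> e\<close>: points on or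
      over it are in the chimney, points below it in a pyramid.\<close>
    show ?thesis
    proof (cases "x \<bullet> e \<le> y")
      case True
      define z where "z = x - y *\<^sub>R b (Suc m) - 0 *\<^sub>R e"
      \<comment> \<open>Chaining the last two inequalities of the larger cone and cancelling
        \<open>Suc m\<close> gives the top inequality of the smaller one.\<close>
      have "real (Suc m) * psum m x \<le> real m * (real (Suc m) * (x \<bullet> e))"
        using psum_x(4) mult_left_mono[OF psum_x(5), of "real m"] by linarith
      then have "real (Suc m) * psum m x \<le> real (Suc m) * (real m * (x \<bullet> e))"
        by (simp only: mult.left_commute)
      then have "psum m x \<le> real m * (x \<bullet> e)"
        by (subst (asm) mult_le_cancel_left_pos) auto
      then have "z \<in> lecture_hall_cone m"
        unfolding z_def y_def using cone_projection[OF x m, of 0] psum_x by simp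
      then obtain F where F: "F \<in> M" "z \<in> convex_cone hull F"
        using M unfolding unimodular_fan_def by blast
      then obtain c where c: "\<And>q. q \<in> F \<Longrightarrow> 0 \<le> c q" "z = (\<Sum>q\<in>F. c q *\<^sub>R q)"
        using convex_cone_hull_eq_sum[OF M_basic(3)] by metis
      have FV: "q \<in> V" if "q \<in> F" for q
        using that F by (auto simp: V_def)
      have "z \<bullet> e = (\<Sum>q\<in>F. c q * (q \<bullet> e))"
        by (simp add: c(2) inner_sum_left)
      also have "\<dots> = sum c F"
        using V(2) FV by (intro sum.cong) auto
      finally have sum_c: "sum c F = x \<bullet> e"
        using m by (simp add: z_def inner_diff_left orth_e)
      have "x = z + y *\<^sub>R b (Suc m)"
        by (simp add: z_def)
      then have "psum m x = psum m z"
        using psum_add_b[of m m z y] m by simp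
      then have "psum m x = (\<Sum>q\<in>F. c q * psum m q)"
        by (simp add: c(2) psum_sum)
      moreover have "(\<Sum>q\<in>F. c q * real (u q)) = (\<Sum>q\<in>F. c q * real (Suc m) - c q * psum m q)"
        by (intro sum.cong) (simp_all add: u(2) FV right_diff_distrib)
      \<comment> \<open>This is the roof height over \<open>z\<close>; that \<open>y\<close> does
        not exceed it is the top inequality of the larger cone.\<close>
      ultimately have "(\<Sum>q\<in>F. c q * real (u q)) = real (Suc m) * sum c F - psum m x"
        by (simp add: sum_subtractf sum_distrib_right mult.commute)
      then have "y \<le> (\<Sum>q\<in>F. c q * real (u q))"
        using psum_x(1,5) sum_c by simp
      then have "\<exists>X\<in>facets. (\<Sum>q\<in>F. c q *\<^sub>R q) + y *\<^sub>R b (Suc m) \<in> convex_cone hull X"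
        using cover_chimney[OF F(1)] c(1) True sum_c by simp
      then show ?thesis
        by (simp add: z_def flip: c(2))
    next
      case False
      \<comment> \<open>Once the multiple \<open>x \<bullet> e - y\<close> of the apex is split off,
        the coefficients of \<open>z\<close> sum to \<open>y\<close>, so raising each vertex to the
        floor restores the vertical part of \<open>x\<close>.\<close>
      define z where "z = x - y *\<^sub>R b (Suc m) - (x \<bullet> e - y) *\<^sub>R e"
      \<comment> \<open>The bound \<open>psum m x \<le> m * y\<close> settles this for positive
        \<open>m\<close>; for \<open>m = 0\<close>, \<open>psum 1 x\<close> is \<open>y\<close>
        itself.\<close>
      have "0 \<le> y"
      proof (cases "m = 0")
        case True
        then show ?thesis
          using psum_x(1,3) by (simp add: psum_0)
      next
        case False
        then show ?thesis
          using order_trans[OF psum_x(2) my] by (simp add: zero_le_mult_iff)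
      qed
      then have "z \<in> lecture_hall_cone m"
        unfolding z_def y_def using cone_projection[OF x m, of "x \<bullet> e - y"] my by (simp add: y_def)
      then obtain F where F: "F \<in> M" "z \<in> convex_cone hull F"
        using M unfolding unimodular_fan_def by blast
      then obtain c where c: "\<And>q. q \<in> F \<Longrightarrow> 0 \<le> c q" "z = (\<Sum>q\<in>F. c q *\<^sub>R q)"
        using convex_cone_hull_eq_sum[OF M_basic(3)] by metis
      have "z \<bullet> e = (\<Sum>q\<in>F. c q * (q \<bullet> e))"
        by (simp add: c(2) inner_sum_left)
      also have "\<dots> = sum c F"
        using V(2) F by (intro sum.cong) (auto simp: V_def)
      finally have sum_c: "sum c F = y"
        using m by (simp add: z_def inner_diff_left orth_e e_e)
      have "(\<Sum>q\<in>F. c q *\<^sub>R (q + b (Suc m))) = z + y *\<^sub>R b (Suc m)"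
        by (simp add: scaleR_add_right sum.distrib c(2) flip: scaleR_sum_left sum_c)
      then have "x = (x \<bullet> e - y) *\<^sub>R e + (\<Sum>q\<in>F. c q *\<^sub>R (q + b (Suc m)))"
        by (simp add: z_def)
      moreover have "(x \<bullet> e - y) *\<^sub>R e + (\<Sum>q\<in>F. c q *\<^sub>R (q + b (Suc m))) \<in> convex_cone hull (pyramid F)"
        using False c(1) by (intro cover_pyramid[OF F(1)]) auto
      ultimately have "x \<in> convex_cone hull (pyramid F)"
        by metis
      then show ?thesis
        using pyramid_in_facets[OF F(1)] by blast
    qed
  qed
  have "clique_closed facets"
    using M by (intro clique_closed_facets) (simp add: unimodular_fan_def)
  moreover have "\<exists>w. supported facets w"
    using M supported_facets[OF _ independent] unfolding unimodular_fan_def by metis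
  ultimately have "unimodular_fan (Suc m) facets"
    unfolding unimodular_fan_def
    using finite_facets facets_nonempty finite_facets_members closure vertices cover
      card_facets[OF M_basic(4)] by blast
  then show ?thesis ..
qed

lemma unimodular_fan_exists: "m \<le> N \<Longrightarrow> \<exists>M. unimodular_fan m M"
proof (induction m)
  case 0
  then show ?case
    using unimodular_fan_0 by blast
next
  case (Suc m)
  then show ?case
    using unimodular_fan_Suc by auto
qed

lemma convex_lecture_hall_cone: "convex (lecture_hall_cone m)"
proof (rule convexI)
  fix x y and s t :: real
  assume x: "x \<in> lecture_hall_cone m" and y: "y \<in> lecture_hall_cone m"
    and st: "0 \<le> s" "0 \<le> t" "s + t = 1"
  let ?z = "s *\<^sub>R x + t *\<^sub>R y"
  have xy: "x = (x \<bullet> e) *\<^sub>R e + (\<Sum>k=1..m. (x \<bullet> b k) *\<^sub>R b k)"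
      "y = (y \<bullet> e) *\<^sub>R e + (\<Sum>k=1..m. (y \<bullet> b k) *\<^sub>R b k)"
    using x y by (simp_all add: lecture_hall_cone_def)
  have "?z = s *\<^sub>R ((x \<bullet> e) *\<^sub>R e + (\<Sum>k=1..m. (x \<bullet> b k) *\<^sub>R b k))
      + t *\<^sub>R ((y \<bullet> e) *\<^sub>R e + (\<Sum>k=1..m. (y \<bullet> b k) *\<^sub>R b k))"
    using xy by simp
  also have "\<dots> = (?z \<bullet> e) *\<^sub>R e + (\<Sum>k=1..m. (?z \<bullet> b k) *\<^sub>R b k)"
    by (simp add: inner_add_left scaleR_add_right scaleR_add_left scaleR_sum_right sum.distrib)
  finally have eq: "?z = (?z \<bullet> e) *\<^sub>R e + (\<Sum>k=1..m. (?z \<bullet> b k) *\<^sub>R b k)" .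
  have le: "s * f + t * g \<le> s * f' + t * g'" if "f \<le> f'" "g \<le> g'" for f f' g g' :: real
    using that st by (intro add_mono mult_left_mono) auto
  have psum_z: "psum i ?z = s * psum i x + t * psum i y" for i
    by (simp add: psum_add psum_scaleR)
  have "real (Suc i) * psum i ?z \<le> real i * psum (Suc i) ?z" if "i < m" for i
    using le[of "real (Suc i) * psum i x" "real i * psum (Suc i) x" "real (Suc i) * psum i y" "real i * psum (Suc i) y"]
      x y that unfolding psum_z by (simp add: lecture_hall_cone_def algebra_simps)
  moreover have "psum m ?z \<le> real m * (?z \<bullet> e)"
    using le[of "psum m x" "real m * (x \<bullet> e)" "psum m y" "real m * (y \<bullet> e)"]
      x y unfolding psum_z by (simp add: lecture_hall_cone_def inner_add_left algebra_simps)
  moreover have "0 \<le> ?z \<bullet> e" "\<forall>i\<le>m. 0 \<le> psum i ?z"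
    using x y st unfolding psum_z by (simp_all add: lecture_hall_cone_def inner_add_left)
  ultimately show "?z \<in> lecture_hall_cone m"
    using eq unfolding lecture_hall_cone_def by blast
qed

end

section \<open>The simplex \<open>R\<^sub>n\<close>\<close>

definition idx :: "nat \<Rightarrow> 'n::{finite,linorder}" where
  "idx = inv_into UNIV pos"

lemma idx_pos: "idx (pos i) = i"
  unfolding idx_def by (rule inv_f_f[OF bij_betw_imp_inj_on[OF bij_betw_pos]])

lemma pos_range: "pos (j :: 'n::{finite,linorder}) \<in> {1..CARD('n)}"
  using bij_betw_pos[where 'n = 'n] by (auto simp: bij_betw_def)

lemma pos_idx:
  assumes "p \<in> {1..CARD('n::{finite,linorder})}"
  shows "pos (idx p :: 'n) = p"
proof -
  have "p \<in> range (pos :: 'n \<Rightarrow> nat)"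
    using bij_betw_pos[where 'n = 'n] assms by (simp add: bij_betw_def)
  then show ?thesis
    unfolding idx_def by (rule f_inv_into_f)
qed

lemma idx_eq_iff:
  "\<lbrakk>p \<in> {1..CARD('n::{finite,linorder})}; q \<in> {1..CARD('n)}\<rbrakk> \<Longrightarrow> (idx p :: 'n) = idx q \<longleftrightarrow> p = q"
  using pos_idx by metis

definition e1 :: "real^'n::{finite,linorder}" where
  "e1 = axis (idx 1) 1"

text \<open>Axes are numbered from the last coordinate, so that \<open>R.psum i x\<close> is the sum
  of the last \<open>i\<close> coordinates. The range up to \<open>CARD('n) - 1\<close> leaves out
  the first coordinate, which belongs to \<open>e1\<close>.\<close>

definition rev_axis :: "nat \<Rightarrow> real^'n::{finite,linorder}" where
  "rev_axis k = axis (idx (CARD('n) + 1 - k)) 1"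

interpretation R: lecture_hall_frame
  "e1 :: real^'n::{finite,linorder}" rev_axis "CARD('n) - 1"
proof
  have card: "1 \<le> CARD('n)"
    by (simp add: Suc_le_eq)
  show "(e1 :: (real, 'n) vec) \<bullet> e1 = 1"
    by (simp add: inner_axis_axis e1_def rev_axis_def)
  show "(e1 :: (real, 'n) vec) \<bullet> rev_axis k = 0" if "k \<in> {1..CARD('n) - 1}" for k
  proof -
    have "(idx 1 :: 'n) \<noteq> idx (CARD('n) + 1 - k)"
      using that card by (subst idx_eq_iff) auto
    then show ?thesis
      by (simp add: inner_axis_axis e1_def rev_axis_def)
  qed
  show "(rev_axis j :: (real, 'n) vec) \<bullet> rev_axis k = (if j = k then 1 else 0)"
    if "j \<in> {1..CARD('n) - 1}" "k \<in> {1..CARD('n) - 1}" for j k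
  proof -
    have "(idx (CARD('n) + 1 - j) :: 'n) = idx (CARD('n) + 1 - k) \<longleftrightarrow> j = k"
      using that card by (subst idx_eq_iff) auto
    then show ?thesis
      by (auto simp: inner_axis_axis rev_axis_def)
  qed
qed

lemma sum_UNIV_rev:
  fixes f :: "'n::{finite,linorder} \<Rightarrow> 'b::comm_monoid_add"
  shows "sum f UNIV = f (idx 1) + (\<Sum>k=1..CARD('n) - 1. f (idx (CARD('n) + 1 - k)))"
proof -
  have "sum f UNIV = (\<Sum>p=1..CARD('n). f (idx p))"
    using sum.reindex_bij_betw[OF bij_betw_pos[where 'n = 'n], of "\<lambda>p. f (idx p)"] by (simp add: idx_pos)
  also have "\<dots> = f (idx 1) + (\<Sum>p=2..CARD('n). f (idx p))"
    by (subst sum.atLeast_Suc_atMost) (simp_all add: Suc_le_eq numeral_2_eq_2)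
  also have "(\<Sum>p=2..CARD('n). f (idx p)) = (\<Sum>k=1..CARD('n) - 1. f (idx (CARD('n) + 1 - k)))"
    by (intro sum.reindex_bij_witness[of _ "\<lambda>k. CARD('n) + 1 - k" "\<lambda>p. CARD('n) + 1 - p"]) auto
  finally show ?thesis .
qed

text \<open>In the top stage this makes the span condition of the cone automatic.\<close>

lemma frame_expansion:
  fixes x :: "real^'n::{finite,linorder}"
  shows "x = (x \<bullet> e1) *\<^sub>R e1 + (\<Sum>k=1..CARD('n) - 1. (x \<bullet> rev_axis k) *\<^sub>R rev_axis k)"
proof -
  have "x = (\<Sum>i\<in>UNIV. (x \<bullet> axis i 1) *\<^sub>R axis i 1)"
    unfolding inner_axis by (simp add: vec_eq_iff axis_def if_distrib cong: if_cong)
  then show ?thesis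
    unfolding e1_def rev_axis_def by (subst (asm) sum_UNIV_rev)
qed

lemma frame_eqI:
  fixes x y :: "real^'n::{finite,linorder}"
  assumes "x \<bullet> e1 = y \<bullet> e1" "\<And>i. i \<le> CARD('n) - 1 \<Longrightarrow> R.psum i x = R.psum i y"
  shows "x = y"
proof -
  have "x \<bullet> rev_axis k = y \<bullet> rev_axis k" if "k \<in> {1..CARD('n) - 1}" for k
  proof -
    have "Suc (k - 1) = k" "k - 1 \<le> CARD('n) - 1"
      using that by auto
    then show ?thesis
      using that assms(2)[of k] assms(2)[of "k - 1"] R.psum_Suc[of "k - 1" x] R.psum_Suc[of "k - 1" y]
      by simp
  qed
  then have "(x \<bullet> e1) *\<^sub>R e1 + (\<Sum>k=1..CARD('n) - 1. (x \<bullet> rev_axis k) *\<^sub>R rev_axis k) =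
      (y \<bullet> e1) *\<^sub>R e1 + (\<Sum>k=1..CARD('n) - 1. (y \<bullet> rev_axis k) *\<^sub>R (rev_axis k :: (real, 'n) vec))"
    using assms(1) by simp
  then show ?thesis
    by (simp only: frame_expansion[symmetric])
qed

section \<open>Columns of the matrix as rays of the cone\<close>

definition col :: "nat \<Rightarrow> real^'n::{finite,linorder}" where
  "col a = column (idx (CARD('n) + 1 - a)) R_matrix"

lemma col_e1:
  assumes "a \<in> {1..CARD('n::{finite,linorder})}"
  shows "(col a :: (real, 'n) vec) \<bullet> e1 = 1"
proof -
  have "pos (idx (CARD('n) + 1 - a) :: 'n) = CARD('n) + 1 - a" "pos (idx 1 :: 'n) = 1"
    using assms by (auto intro!: pos_idx)
  then show ?thesis
    using assms by (auto simp: inner_axis e1_def col_def column_def R_matrix_def)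
qed

text \<open>Numbering the columns from the right makes \<open>a\<close> the diagonal entry and sends
  the entries above the diagonal to the axes \<open>k > a\<close>. The column
  \<open>a = CARD('n)\<close> is \<open>e1\<close>.\<close>

lemma col_rev_axis:
  assumes "a \<in> {1..CARD('n::{finite,linorder})}" "k \<in> {1..CARD('n) - 1}"
  shows "(col a :: (real, 'n) vec) \<bullet> rev_axis k = (if k < a then 0 else if k = a then real a else 1)"
proof -
  have "pos (idx (CARD('n) + 1 - a) :: 'n) = CARD('n) + 1 - a"
      "pos (idx (CARD('n) + 1 - k) :: 'n) = CARD('n) + 1 - k"
    using assms by (auto intro!: pos_idx)
  then show ?thesis
    using assms by (auto simp: inner_axis rev_axis_def col_def column_def R_matrix_def of_nat_diff)
qed

text \<open>The diagonal entry lifts the partial sum to \<open>a\<close> at once, and the ones after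
  it keep it equal to \<open>i\<close>: the ratios jump from zero to one at
  \<open>i = a\<close>.\<close>

lemma psum_col:
  assumes "a \<in> {1..CARD('n::{finite,linorder})}" "i \<le> CARD('n) - 1"
  shows "R.psum i (col a :: (real, 'n) vec) = (if i < a then 0 else real i)"
  using assms(2)
proof (induction i)
  case 0
  then show ?case
    by (simp add: R.psum_0)
next
  case (Suc i)
  then show ?case
    using col_rev_axis[OF assms(1), of "Suc i"] by (auto simp: R.psum_Suc)
qed

lemma col_in_cone:
  assumes "a \<in> {1..CARD('n::{finite,linorder})}"
  shows "(col a :: (real, 'n) vec) \<in> R.lecture_hall_cone (CARD('n) - 1)"
  unfolding R.lecture_hall_cone_def
proof (intro CollectI conjI)
  let ?c = "col a :: (real, 'n) vec"
  show "?c = (?c \<bullet> e1) *\<^sub>R e1 + (\<Sum>k=1..CARD('n) - 1. (?c \<bullet> rev_axis k) *\<^sub>R rev_axis k)"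
    by (rule frame_expansion)
qed (simp_all add: col_e1[OF assms] psum_col[OF assms])

lemma columns_eq: "columns R_matrix = (col :: nat \<Rightarrow> real^'n::{finite,linorder}) ` {1..CARD('n)}"
proof (intro equalityI subsetI)
  fix v :: "(real, 'n) vec" assume "v \<in> columns R_matrix"
  then obtain j where "v = column j R_matrix"
    by (auto simp: columns_def)
  then have "v = col (CARD('n) + 1 - pos j)"
    using pos_range[of j] by (simp add: col_def idx_pos)
  then show "v \<in> col ` {1..CARD('n)}"
    using pos_range[of j] by (intro image_eqI[of _ _ "CARD('n) + 1 - pos j"]) auto
qed (auto simp: columns_def col_def)

text \<open>The ratios \<open>R.psum a x / a\<close> increase from zero to one, and each column
  contributes a single jump, so the increments of the ratios are the barycentric
  coordinates.\<close>

lemma cone_in_R_polytope: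
  fixes x :: "real^'n::{finite,linorder}"
  assumes x: "x \<in> R.lecture_hall_cone (CARD('n) - 1)" "x \<bullet> e1 = 1"
  shows "x \<in> R_polytope"
proof -
  define n where "n = CARD('n)"
  have n: "1 \<le> n"
    by (simp add: n_def Suc_le_eq)
  have C: "\<And>i. i \<le> n - 1 \<Longrightarrow> 0 \<le> R.psum i x"
      "\<And>i. i < n - 1 \<Longrightarrow> real (Suc i) * R.psum i x \<le> real i * R.psum (Suc i) x"
      "R.psum (n - 1) x \<le> real (n - 1)"
    using x unfolding n_def R.lecture_hall_cone_def by auto
  \<comment> \<open>The value at \<open>n\<close> closes the chain of ratios with the bound
    \<open>x \<bullet> e1 = 1\<close>; at zero, division by zero yields the required start
    \<open>s 0 = 0\<close>.\<close>
  define s where "s = (\<lambda>a. if a = n then 1 else R.psum a x / real a)"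
  define t where "t = (\<lambda>a. s a - s (a - 1))"
  have s_0: "s 0 = 0"
    using n by (simp add: s_def)
  have sum_t: "(\<Sum>a=1..i. t a) = s i" for i
    by (induction i) (simp_all add: t_def s_0)
  have t_nonneg: "0 \<le> t a" if a: "a \<in> {1..n}" for a
  proof -
    obtain i where i: "a = Suc i"
      using a by (cases a) auto
    have "s i \<le> s (Suc i)"
    proof (cases "i = 0")
      case True
      then show ?thesis
        using C(1)[of 1] i a by (auto simp: s_0) (auto simp: s_def)
    next
      case False
      show ?thesis
      proof (cases "Suc i = n")
        case True
        then show ?thesis
          using C(3) False by (auto simp: s_def field_simps)
      next
        case neq: False
        then have "real (Suc i) * R.psum i x \<le> real i * R.psum (Suc i) x"
          using a i neq by (intro C(2)) auto
        then show ?thesis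
          using neq False a i by (simp add: s_def field_simps)
      qed
    qed
    then show ?thesis
      by (simp add: t_def i)
  qed
  have sum_n: "(\<Sum>a=1..n. t a) = 1"
    unfolding sum_t by (simp add: s_def)
  define z :: "(real, 'n) vec" where "z = (\<Sum>a=1..n. t a *\<^sub>R col a)"
  have "x = z"
  proof (rule frame_eqI)
    have "z \<bullet> e1 = (\<Sum>a=1..n. t a * (col a \<bullet> (e1 :: (real, 'n) vec)))"
      by (simp add: z_def inner_sum_left)
    also have "\<dots> = (\<Sum>a=1..n. t a)"
      by (intro sum.cong) (auto simp: col_e1 n_def)
    finally show "x \<bullet> e1 = z \<bullet> e1"
      using x(2) sum_n by simp
    fix i assume i: "i \<le> CARD('n) - 1"
    have "R.psum i z = (\<Sum>a=1..n. t a * (if i < a then 0 else real i))"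
      unfolding z_def R.psum_sum using psum_col[OF _ i] by (intro sum.cong) (simp_all add: n_def)
    also have "\<dots> = (\<Sum>a=1..i. t a * real i)"
      using i n by (intro sum.mono_neutral_cong_right) (auto simp: n_def)
    also have "\<dots> = s i * real i"
      by (simp only: sum_t flip: sum_distrib_right)
    also have "\<dots> = R.psum i x"
      using i n by (cases "i = 0") (auto simp: s_def n_def R.psum_0)
    finally show "R.psum i x = R.psum i z"
      by simp
  qed
  moreover have "z \<in> R_polytope"
    unfolding R_polytope_def columns_eq z_def
  proof (rule convex_sum)
    show "col a \<in> convex hull ((col :: nat \<Rightarrow> (real, 'n) vec) ` {1..CARD('n)})" if "a \<in> {1..n}" for a
      using that by (intro hull_inc) (auto simp: n_def)
  qed (use sum_n t_nonneg in auto)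
  ultimately show ?thesis
    by simp
qed

lemma R_polytope_eq:
  "R_polytope = {x :: real^'n::{finite,linorder}. x \<in> R.lecture_hall_cone (CARD('n) - 1) \<and> x \<bullet> e1 = 1}"
    (is "_ = ?Q")
proof
  have "?Q = R.lecture_hall_cone (CARD('n) - 1) \<inter> {x. e1 \<bullet> x = 1}"
    by (auto simp: inner_commute)
  then have "convex ?Q"
    using R.convex_lecture_hall_cone by (metis convex_Int convex_hyperplane)
  then show "R_polytope \<subseteq> ?Q"
    unfolding R_polytope_def columns_eq
    by (intro hull_minimal) (use col_in_cone[where 'n = 'n] col_e1[where 'n = 'n] in auto)
  show "?Q \<subseteq> R_polytope"
    using cone_in_R_polytope by blast
qed

section \<open>The slice at first coordinate one and its lattice\<close>

lemma convex_cone_hull_slice: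
  assumes "x \<in> convex_cone hull F" "\<And>v. v \<in> F \<Longrightarrow> v \<bullet> e = 1" "x \<bullet> e = 1"
  shows "x \<in> convex hull F"
proof -
  have "x \<noteq> 0"
    using assms(3) by auto
  then obtain r y where y: "0 \<le> r" "y \<in> convex hull F" "x = r *\<^sub>R y"
    using assms(1) unfolding convex_cone_hull_convex_hull by blast
  have "convex hull F \<subseteq> {v. e \<bullet> v = 1}"
    using assms(2) by (intro hull_minimal convex_hyperplane) (auto simp: inner_commute)
  then have "r = 1"
    using y(2,3) assms(3) by (auto simp: inner_commute)
  then show ?thesis
    using y by simp
qed

lemma R_lattice_group_closure:
  fixes x :: "real^'n::{finite,linorder}"
  assumes "x \<in> R_lattice"
  shows "x \<in> group_closure (insert e1 (rev_axis ` {1..CARD('n) - 1}))"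
    (is "_ \<in> group_closure ?B")
proof -
  have int: "r *\<^sub>R v \<in> group_closure ?B" if r: "r \<in> \<int>" and v: "v \<in> ?B" for r v
  proof -
    obtain z where z: "r = of_int z"
      using r by (rule Ints_cases)
    have v: "v \<in> group_closure ?B"
      using v by (auto intro: group_closure.base)
    show ?thesis
    proof (cases "0 \<le> z")
      case True
      then show ?thesis
        using group_closure_of_nat_scaleR[OF v, of "nat z"] z by simp
    next
      case False
      then have "- (r *\<^sub>R v) \<in> group_closure ?B"
        using group_closure_of_nat_scaleR[OF v, of "nat (- z)"] z by simp
      then show ?thesis
        using group_closure_minus_iff by blast
    qed
  qed
  have sum: "(\<Sum>k\<in>A. f k) \<in> group_closure ?B" if "\<And>k. k \<in> A \<Longrightarrow> f k \<in> group_closure ?B" for A :: "nat set" and f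
    using that by (induction A rule: infinite_finite_induct) (auto intro: group_closure_add)
  have "x \<bullet> axis i 1 \<in> \<int>" for i
    using assms by (simp add: R_lattice_def inner_axis)
  then have "x \<bullet> e1 \<in> \<int>" "\<And>k. x \<bullet> rev_axis k \<in> \<int>"
    by (simp_all add: e1_def rev_axis_def)
  then have "(x \<bullet> e1) *\<^sub>R e1 + (\<Sum>k=1..CARD('n) - 1. (x \<bullet> rev_axis k) *\<^sub>R rev_axis k) \<in> group_closure ?B"
    by (intro group_closure_add sum int) auto
  then show ?thesis
    using frame_expansion[of x] by simp
qed

lemma mem_R_latticeI:
  fixes v :: "real^'n::{finite,linorder}"
  assumes "v \<bullet> e1 = 1" "\<forall>k\<in>{1..CARD('n) - 1}. v \<bullet> rev_axis k \<in> \<nat>"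
  shows "v \<in> R_lattice"
proof -
  have "v $ i \<in> \<int> \<and> (pos i = 1 \<longrightarrow> v $ i = 1)" for i
  proof (cases "pos i = 1")
    case True
    then have "i = idx 1"
      using idx_pos[of i] by simp
    then show ?thesis
      using assms(1) by (simp add: inner_axis e1_def)
  next
    case False
    then have "v \<bullet> rev_axis (CARD('n) + 1 - pos i) \<in> \<nat>"
      using assms(2) pos_range[of i] by (intro bspec[OF assms(2)]) auto
    moreover have "CARD('n) + 1 - (CARD('n) + 1 - pos i) = pos i"
      using pos_range[of i] by auto
    ultimately have "v $ i \<in> \<nat>"
      by (simp add: inner_axis idx_pos rev_axis_def)
    then show ?thesis
      using False Nats_subset_Ints by blast
  qed
  then show ?thesis
    by (simp add: R_lattice_def)
qed

lemma R_lattice_affine_combination: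
  fixes F :: "(real^'n::{finite,linorder}) set"
  assumes "F \<subseteq> R_lattice" "sum c F = (1::int)"
  shows "(\<Sum>v\<in>F. of_int (c v) *\<^sub>R v) \<in> R_lattice"
proof -
  have "(\<Sum>v\<in>F. of_int (c v) * v $ i) \<in> \<int>" for i
    using assms(1) by (intro Ints_sum Ints_mult) (auto simp: R_lattice_def)
  moreover have "(\<Sum>v\<in>F. of_int (c v) * v $ i) = 1" if "pos i = 1" for i
  proof -
    have "(\<Sum>v\<in>F. of_int (c v) * v $ i) = (\<Sum>v\<in>F. of_int (c v))"
      using assms(1) that by (intro sum.cong) (auto simp: R_lattice_def)
    also have "\<dots> = real_of_int (sum c F)"
      by simp
    finally show ?thesis
      using assms(2) by simp
  qed
  ultimately show ?thesis
    by (simp add: R_lattice_def)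
qed

section \<open>Assembling the triangulation\<close>

theorem theorem5:
  shows "\<exists>\<T> :: (real^('n::{finite,linorder})) set set.
           triangulates \<T> R_polytope \<and>
           regular_triangulation R_polytope \<T> \<and>
           flag_triangulation \<T> \<and>
           unimodular_triangulation R_lattice \<T>"
proof -
  obtain M :: "((real, 'n) vec) set set" where M: "R.unimodular_fan (CARD('n) - 1) M"
    using R.unimodular_fan_exists by blast
  obtain w where w: "supported M w"
    using M unfolding R.unimodular_fan_def by blast
  have V: "v \<in> R.lecture_hall_cone (CARD('n) - 1)" "v \<bullet> e1 = 1" "v \<in> R_lattice" if "v \<in> \<Union>M" for v
    using M that mem_R_latticeI[of v] unfolding R.unimodular_fan_def by blast+
  have facet: "independent F" "card F = Suc (CARD('n) - 1)" "finite F" if "F \<in> M" for F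
    using R.unimodular_fan_independent[OF M that] M that unfolding R.unimodular_fan_def by auto
  interpret weighted_facets M w
  proof
    show "finite M" "M \<noteq> {}"
      using M unfolding R.unimodular_fan_def by auto
    show "\<not> affine_dependent F" if "F \<in> M" for F
      using facet(1)[OF that] affine_dependent_imp_dependent by blast
    \<comment> \<open>All facets have the same number of vertices, so inclusion forces
      equality.\<close>
    show "F = F'" if "F \<in> M" "F' \<in> M" "F \<subseteq> F'" for F F'
      using facet that by (metis card_subset_eq)
    show "\<exists>a c. (\<forall>v\<in>F. a \<bullet> v + c = w v) \<and> (\<forall>v\<in>\<Union>M - F. a \<bullet> v + c < w v)" if "F \<in> M" for F
      using bspec[OF w[unfolded supported_def] that] by (metis add.right_neutral)
  qed
  have P: "R_polytope = (\<Union>F\<in>M. convex hull F)"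
  proof (intro equalityI subsetI)
    fix x :: "(real, 'n) vec" assume "x \<in> R_polytope"
    then have x: "x \<in> R.lecture_hall_cone (CARD('n) - 1)" "x \<bullet> e1 = 1"
      unfolding R_polytope_eq by auto
    then obtain F where "F \<in> M" "x \<in> convex_cone hull F"
      using M unfolding R.unimodular_fan_def by blast
    then show "x \<in> (\<Union>F\<in>M. convex hull F)"
      using convex_cone_hull_slice[of x F e1] x(2) V(2) by blast
  next
    fix x assume "x \<in> (\<Union>F\<in>M. convex hull F)"
    then obtain F where F: "F \<in> M" "x \<in> convex hull F"
      by blast
    have "convex (R_polytope :: ((real, 'n) vec) set)"
      by (simp add: R_polytope_def)
    moreover have "F \<subseteq> R_polytope"
      using V F(1) unfolding R_polytope_eq by blast
    ultimately show "x \<in> R_polytope"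
      using F(2) hull_minimal by blast
  qed
  have unimodular: "unimodular_simplex R_lattice (convex hull F)" if F: "F \<in> M" for F
    unfolding unimodular_simplex_def vertices_convex_hull[OF F order_refl]
  proof (intro conjI equalityI subsetI)
    show "\<exists>d. d simplex (convex hull F)"
      using indep[OF F] unfolding simplex_def by (intro exI[of _ "int (card F) - 1"]) auto
  next
    fix x :: "(real, 'n) vec" assume x: "x \<in> R_lattice"
    have "insert e1 (rev_axis ` {1..CARD('n) - 1}) \<subseteq> group_closure F"
      using M F unfolding R.unimodular_fan_def by blast
    then have "x \<in> group_closure F"
      using R_lattice_group_closure[OF x] group_closure_subset by blast
    then obtain c :: "(real, 'n) vec \<Rightarrow> int" where c: "x = (\<Sum>v\<in>F. of_int (c v) *\<^sub>R v)"
      using group_closure_eq_sum[OF facet(3)[OF F]] by blast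
    \<comment> \<open>All vertices have first coordinate one, so comparing first coordinates shows
      that the integer combination is affine.\<close>
    have "x \<bullet> e1 = (\<Sum>v\<in>F. of_int (c v) * (v \<bullet> e1))"
      by (simp add: c inner_sum_left)
    also have "\<dots> = (\<Sum>v\<in>F. of_int (c v))"
      using V(2) F by (intro sum.cong) auto
    finally have "real_of_int (sum c F) = x \<bullet> e1"
      by simp
    also have "x \<bullet> e1 = 1"
      using x pos_idx[of 1, where 'n = 'n] by (simp add: R_lattice_def inner_axis e1_def Suc_le_eq)
    finally have "sum c F = 1"
      by linarith
    then show "x \<in> {\<Sum>v\<in>F. of_int (c v) *\<^sub>R v |c :: (real, 'n) vec \<Rightarrow> int. sum c F = 1}"
      using c by blast
  next
    fix x :: "(real, 'n) vec" assume "x \<in> {\<Sum>v\<in>F. of_int (c v) *\<^sub>R v |c :: (real, 'n) vec \<Rightarrow> int. sum c F = 1}"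
    moreover have "F \<subseteq> R_lattice"
      using V(3) F by blast
    ultimately show "x \<in> R_lattice"
      using R_lattice_affine_combination by blast
  qed
  have flag: "\<exists>F\<in>M. W \<subseteq> F"
    if "W \<subseteq> \<Union>M" "\<And>p q. p \<in> W \<Longrightarrow> q \<in> W \<Longrightarrow> \<exists>F\<in>M. {p, q} \<subseteq> F" for W
  proof -
    have "clique_closed M"
      using M unfolding R.unimodular_fan_def by blast
    then show ?thesis
      using that unfolding clique_closed_def by simp
  qed
  show ?thesis
  proof (intro exI conjI)
    show "triangulates simplices R_polytope"
      using triangulates_simplices P by simp
    show "regular_triangulation R_polytope simplices"
      by (intro regular_triangulation_simplices P) (simp add: R_polytope_def)
    show "flag_triangulation simplices"
      by (rule flag_triangulation_simplices[OF flag])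
    show "unimodular_triangulation R_lattice simplices"
      unfolding unimodular_triangulation_def maximal_simplices_eq using unimodular by blast
  qed
qed

end
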